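(* For every nonzero integer $n$, $A_n\le 21$. That is, if $S$ is any set of positive integers with the property $D(n)$, then $S$ contains at most $21$ elements $x$ with $x\ge |n|^3$.
   Context: Let $n$ be a nonzero integer. A set of positive integers $S$ has the property $D(n)$ if $xy+n$ is a perfect square (square of an integer) for all distinct $x,y\in S$. Define $A_n=\sup\{|S\cap[|n|^3,+\infty)| : S \text{ has the property } D(n)\}$. *)

theory Defs
  imports Main
begin

definition has_property_D :: "int \<Rightarrow> int set \<Rightarrow> bool" where
  "has_property_D n S \<longleftrightarrow>
     (\<forall>x\<in>S. \<forall>y\<in>S. x \<noteq> y \<longrightarrow> (\<exists>m::int. x * y + n = m ^ 2))"

end

theory Submission
  imports Defs Complex_Main "HOL-Computational_Algebra.Polynomial" "HOL-Number_Theory.Fib"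
begin

text \<open>
  Let $a < b < c < d$ be elements of $S$ above $|n|^3$, let $N = abc$, $ac + n = s^2$ and
  $bc + n = t^2$. The square roots of $u_0 = N$, $u_1 = bs^2 = N + nb$ and $u_2 = at^2 = N + na$ are
  in the ratio of the integers $abz$, $bsx$, $aty$ up to an error of order $d^{-1/2}$, where
  $x^2 = ad + n$, $y^2 = bd + n$, $z^2 = cd + n$. The divided difference of $v^{k - 1/2}$ at
  $u_0, u_1, u_2$, each of multiplicity $k$, is a linear form $\sum_j c_j \sqrt{u_j}$ with rational
  $c_j$ of controlled size and denominator, and by the mean value theorem for divided differences it
  is, with known constants, of exact order $N^{1/2 - 2k}$. Replacing the square roots by the integers
  gives a rational number that is too small for its denominator unless it vanishes, yet it is nonzero
  since the linear form dominates the error. This excludes $d$ from an interval depending on $k$; if $c$ is large compared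
  with $b$, these intervals overlap and cover everything beyond a fixed power of $N$. The gap
  principle $n^2 d \ge 2bc$ makes the elements grow like $V^{F_i}$ with Fibonacci exponents,
  so that the 2nd, 13th and 22nd element contradict this.
\<close>

subsection \<open>Rolle's theorem with multiplicities\<close>

text \<open>Induct by adjoining a new maximum \<open>b\<close>: the mean value theorem on
  \<open>{Max W..b}\<close> gives one further critical point strictly inside that gap. Keeping
  \<open>Y\<close> disjoint from \<open>Z\<close> lets the new zeros be counted alongside the
  multiplicities at the old ones.\<close>

lemma rolle_points:
  fixes f f' :: "real \<Rightarrow> real"
  assumes "finite Z" "Z \<noteq> {}" "Z \<subseteq> {A..B}"
    and der: "\<And>x. x \<in> {A..B} \<Longrightarrow> (f has_real_derivative f' x) (at x)"
    and "\<And>z. z \<in> Z \<Longrightarrow> f z = 0"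
  shows "\<exists>Y. finite Y \<and> Y \<inter> Z = {} \<and> Y \<subseteq> {Min Z..Max Z} \<and> Suc (card Y) = card Z \<and> (\<forall>y\<in>Y. f' y = 0)"
  using assms(1,2,3,5)
proof (induction rule: finite_linorder_max_induct)
  case empty
  then show ?case by simp
next
  case (insert b W)
  show ?case
  proof (cases "W = {}")
    case True
    then show ?thesis by (intro exI[of _ "{}"]) auto
  next
    case False
    obtain Y where Y: "finite Y" "Y \<inter> W = {}" "Y \<subseteq> {Min W..Max W}" "Suc (card Y) = card W"
      "\<forall>y\<in>Y. f' y = 0"
      using insert.IH[OF False] insert.prems by auto
    have lt: "Max W < b" using insert.hyps False by simp
    have MW: "Max W \<in> W" using insert.hyps False by simp
    have sub: "{Max W..b} \<subseteq> {A..B}" using MW insert.prems by auto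
    have "\<exists>z. Max W < z \<and> z < b \<and> f' z = 0"
    proof (rule ccontr)
      assume no: "\<not> ?thesis"
      have "\<exists>z>Max W. z < b \<and> f b - f (Max W) = (b - Max W) * f' z"
        by (rule MVT2[OF lt]) (use sub der in auto)
      moreover have "f b = 0" "f (Max W) = 0" using insert.prems MW by auto
      ultimately show False using no lt by auto
    qed
    then obtain z where z: "Max W < z" "z < b" "f' z = 0" by blast
    have zW: "z \<notin> W" using z(1) insert.hyps(1) by (metis Max_ge leD)
    have zY: "z \<notin> Y" using Y(3) z(1) by auto
    have bY: "b \<notin> Y" using Y(3) lt by auto
    have MinW: "Min (insert b W) = Min W"
      using Min_insert[OF insert.hyps(1) False, of b] lt Min_le[OF insert.hyps(1) MW] by linarith
    have MaxW: "Max (insert b W) = b"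
      using Max_insert[OF insert.hyps(1) False, of b] lt by linarith
    have bW: "b \<notin> W" using insert.hyps by auto
    have Minz: "Min W \<le> z" using Min_le[OF insert.hyps(1) MW] z(1) by linarith
    have "insert z Y \<inter> insert b W = {}" using Y(2) zW bY z(2) by auto
    moreover have "insert z Y \<subseteq> {Min W..b}" using Y(3) Minz z(2) lt by fastforce
    moreover have "Suc (card (insert z Y)) = card (insert b W)"
      using Y(1,4) zY bW insert.hyps(1) by simp
    ultimately show ?thesis
      unfolding MinW MaxW using Y(1,5) z(3) by (intro exI[of _ "insert z Y"]) simp
  qed
qed

text \<open>Here \<open>f i\<close> is the \<open>i\<close>-th derivative of \<open>f 0\<close> and
  \<open>w\<close> gives multiplicities of zeros. Differentiation lowers each positive multiplicity
  by one and Rolle adds a simple zero in each gap, so the total drops by exactly one; after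
  \<open>r\<close> rounds a zero is left.\<close>

lemma generalised_rolle:
  fixes f :: "nat \<Rightarrow> real \<Rightarrow> real" and w :: "real \<Rightarrow> nat"
  assumes "\<And>i x. x \<in> {A..B} \<Longrightarrow> (f i has_real_derivative f (Suc i) x) (at x)"
    and "finite Z" "Z \<subseteq> {A..B}" "r < sum w Z"
    and "\<And>z i. z \<in> Z \<Longrightarrow> i < w z \<Longrightarrow> f i z = 0"
  shows "\<exists>\<xi>\<in>{A..B}. f r \<xi> = 0"
  using assms
proof (induction r arbitrary: f Z w)
  case 0
  then obtain z where "z \<in> Z" "0 < w z" by (metis gr0I not_less0 sum.neutral)
  with 0 show ?case by blast
next
  case (Suc r)
  \<comment> \<open>Points of weight zero need not be zeros of \<open>f 0\<close>, so only the
    others may enter Rolle's theorem.\<close>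
  define Z1 where "Z1 = {z \<in> Z. 0 < w z}"
  have fin: "finite Z1" and sub: "Z1 \<subseteq> Z" using Suc.prems by (auto simp: Z1_def)
  have sum1: "sum w Z1 = sum w Z"
    by (rule sum.mono_neutral_left) (use Suc.prems in \<open>auto simp: Z1_def\<close>)
  have ne: "Z1 \<noteq> {}" using sum1 Suc.prems(4) by auto
  have f0: "f 0 z = 0" if "z \<in> Z1" for z using that Suc.prems(5)[of z 0] by (auto simp: Z1_def)
  have "\<exists>Y. finite Y \<and> Y \<inter> Z1 = {} \<and> Y \<subseteq> {Min Z1..Max Z1} \<and> Suc (card Y) = card Z1
      \<and> (\<forall>y\<in>Y. f (Suc 0) y = 0)"
    by (rule rolle_points[OF fin ne _ Suc.prems(1) f0]) (use sub Suc.prems(3) in auto)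
  then obtain Y where Y: "finite Y" "Y \<inter> Z1 = {}" "Y \<subseteq> {Min Z1..Max Z1}" "Suc (card Y) = card Z1"
      "\<forall>y\<in>Y. f (Suc 0) y = 0"
    by blast
  have YAB: "Y \<subseteq> {A..B}"
    using Y(3) Min_in[OF fin ne] Max_in[OF fin ne] sub Suc.prems(3) by fastforce
  define w' where "w' z = (if z \<in> Z1 then w z - 1 else 1)" for z
  have "sum w' (Z1 \<union> Y) = sum w' Z1 + sum w' Y"
    by (rule sum.union_disjoint) (use fin Y in auto)
  moreover have "sum w' Y = card Y"
    unfolding card_eq_sum by (rule sum.cong) (use Y(2) in \<open>auto simp: w'_def\<close>)
  moreover have "sum w' Z1 + card Z1 = sum w Z1"
    unfolding card_eq_sum sum.distrib[symmetric]
    by (rule sum.cong) (auto simp: w'_def Z1_def)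
  ultimately have "Suc (sum w' (Z1 \<union> Y)) = sum w Z" using Y(4) sum1 by linarith
  then have lt: "r < sum w' (Z1 \<union> Y)" using Suc.prems(4) by linarith
  show ?case
  proof (rule Suc.IH[of "\<lambda>i. f (Suc i)" "Z1 \<union> Y" w'])
    show "\<And>z i. z \<in> Z1 \<union> Y \<Longrightarrow> i < w' z \<Longrightarrow> f (Suc i) z = 0"
      using Suc.prems(5) Y sub by (auto simp: w'_def split: if_splits)
  qed (use Suc.prems fin Y YAB sub lt in auto)
qed

section \<open>Higher derivatives of polynomials\<close>

text \<open>Leibniz's rule with only two surviving terms, as \<open>q\<close> is linear. For
  \<open>i = 0\<close> the truncated index \<open>i - 1\<close> is harmless because its coefficient
  is zero.\<close>

lemma higher_pderiv_linear_mult: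
  fixes p q :: "real poly"
  assumes "pderiv q = 1"
  shows "(pderiv ^^ i) (q * p) = q * (pderiv ^^ i) p + of_nat i * (pderiv ^^ (i - 1)) p"
proof (induction i)
  case 0
  show ?case by simp
next
  case (Suc i)
  have "pderiv (of_nat i * (pderiv ^^ (i - 1)) p) = of_nat i * (pderiv ^^ i) p"
    by (cases i) (simp_all add: pderiv_mult pderiv_of_nat del: of_nat_Suc)
  moreover have "pderiv (q * (pderiv ^^ i) p) = q * (pderiv ^^ Suc i) p + (pderiv ^^ i) p"
    by (simp add: pderiv_mult assms)
  ultimately show ?case
    by (simp add: Suc pderiv_add distrib_right)
qed

text \<open>In Leibniz's rule the linear factor vanishes at \<open>u\<close>, so both exponents drop
  together. Up to factorials the powers of \<open>x - u\<close> are dual to the derivatives at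
  \<open>u\<close>, which is why Taylor polynomials interpolate.\<close>

lemma higher_pderiv_linear_power:
  fixes u :: real
  shows "poly ((pderiv ^^ i) ([:- u, 1:] ^ n)) u = (if i = n then fact n else 0)"
proof (induction n arbitrary: i)
  case 0
  have "(pderiv ^^ Suc m) 1 = (0 :: real poly)" for m
    by (induction m) simp_all
  then show ?case by (cases i) (auto simp del: funpow.simps(2) intro: arg_cong[where f = "\<lambda>p. poly p u"])
next
  case (Suc n)
  have "pderiv [:- u, 1:] = 1" by (simp add: pderiv_pCons)
  then have "poly ((pderiv ^^ i) ([:- u, 1:] ^ Suc n)) u
      = of_nat i * poly ((pderiv ^^ (i - 1)) ([:- u, 1:] ^ n)) u"
    unfolding power_Suc by (subst higher_pderiv_linear_mult) simp_all
  then show ?case by (cases i) (auto simp: Suc simp del: power_Suc funpow.simps)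
qed

text \<open>The \<open>r\<close>-th derivative is constant, so its value at any point, in particular
  at the one found by Rolle, reveals the top coefficient, which is the divided difference.\<close>

lemma poly_higher_pderiv_degree_le:
  fixes p :: "real poly"
  assumes "degree p \<le> r"
  shows "poly ((pderiv ^^ r) p) x = fact r * coeff p r"
proof -
  have "degree ((pderiv ^^ r) p) = 0" using assms by (simp add: degree_higher_pderiv)
  then obtain a where a: "(pderiv ^^ r) p = [:a:]" by (metis degree_eq_zeroE)
  have "coeff ((pderiv ^^ r) p) 0 = fact r * coeff p r"
    by (simp add: coeff_higher_pderiv pochhammer_fact)
  with a show ?thesis by simp
qed

subsection \<open>Derivatives of half-integral powers\<close>

lemma gchoose_half_Suc:
  fixes k h :: nat
  shows "(real (Suc k) - 1/2) gchoose Suc h = ((real k - 1/2) gchoose Suc h) + ((real k - 1/2) gchoose h)"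
proof -
  have e: "real (Suc k) - 1/2 = (real k - 1/2) + 1" by simp
  show ?thesis unfolding e gbinomial_Suc_Suc by (rule add.commute)
qed

text \<open>For \<open>k = 0\<close> the number is a central binomial coefficient up to sign, by
  comparing the two recursions in \<open>h\<close>; Pascal's rule then raises
  \<open>k\<close>.\<close>

lemma gchoose_half_int: "4 ^ h * ((real k - 1/2) gchoose h) \<in> \<int>"
proof (induction k arbitrary: h)
  case 0
  have "4 ^ h * ((- 1/2 :: real) gchoose h) = (- 1) ^ h * real ((2 * h) choose h)"
  proof (induction h)
    case (Suc h)
    have "real (Suc h) * ((- 1/2 :: real) gchoose Suc h) = (- 1/2 - real h) * ((- 1/2) gchoose h)"
      using gbinomial_mult_1[of "- 1/2 :: real" h] by (simp add: algebra_simps)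
    moreover have "real (Suc h) * real ((2 * Suc h) choose Suc h) = 2 * real (2 * h + 1) * real ((2 * h) choose h)"
    proof -
      have "Suc h * ((2 * Suc h) choose Suc h) = 2 * (2 * h + 1) * ((2 * h) choose h)"
      proof -
        have "Suc h * (Suc (2 * h + 1) choose Suc h) = Suc (2 * h + 1) * ((2 * h + 1) choose h)"
          using Suc_times_binomial_eq[of "2 * h + 1" h] by (simp only: mult.commute)
        moreover have "Suc h * ((2 * h + 1) choose h) = (2 * h + 1) * ((2 * h) choose h)"
        proof -
          have "(2 * h + 1) choose h = Suc (2 * h) choose Suc h"
            using binomial_symmetric[of h "2 * h + 1"] by simp
          then show ?thesis using Suc_times_binomial_eq[of "2 * h" h] by (simp only: mult.commute Suc_eq_plus1)
        qed
        moreover have "Suc (2 * h + 1) = 2 * Suc h" "2 * Suc h = Suc (2 * h + 1)" by simp_all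
        ultimately show ?thesis by (metis mult.assoc mult.commute)
      qed
      then show ?thesis by (metis (no_types, opaque_lifting) of_nat_mult of_nat_numeral)
    qed
    ultimately have a: "real (Suc h) * ((- 1/2 :: real) gchoose Suc h) = (- 1/2 - real h) * ((- 1/2) gchoose h)"
      and b: "real (Suc h) * real ((2 * Suc h) choose Suc h) = 2 * real (2 * h + 1) * real ((2 * h) choose h)"
      by blast+
    have "real (Suc h) * (4 ^ Suc h * ((- 1/2 :: real) gchoose Suc h))
       = 4 * 4 ^ h * (real (Suc h) * ((- 1/2 :: real) gchoose Suc h))"
      by simp
    also have "\<dots> = - (2 * real (2 * h + 1)) * (4 ^ h * ((- 1/2 :: real) gchoose h))"
      unfolding a by (simp add: algebra_simps)
    also have "\<dots> = (- 1) ^ Suc h * (2 * real (2 * h + 1) * real ((2 * h) choose h))"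
      unfolding Suc by (simp add: algebra_simps)
    also have "\<dots> = real (Suc h) * ((- 1) ^ Suc h * real ((2 * Suc h) choose Suc h))"
      unfolding b[symmetric] by (rule mult.left_commute)
    finally have "real (Suc h) * (4 ^ Suc h * ((- 1/2 :: real) gchoose Suc h))
       = real (Suc h) * ((- 1) ^ Suc h * real ((2 * Suc h) choose Suc h))" .
    then show ?case by (rule mult_left_cancel[THEN iffD1, rotated]) simp
  qed simp
  then show ?case by simp
next
  case (Suc k)
  show ?case
  proof (cases h)
    case (Suc h')
    have "4 ^ h * ((real (Suc k) - 1/2) gchoose h) =
       4 ^ Suc h' * ((real k - 1/2) gchoose Suc h') + 4 * (4 ^ h' * ((real k - 1/2) gchoose h'))"
      unfolding Suc gchoose_half_Suc by (simp add: algebra_simps)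
    then show ?thesis using Suc.IH[of "Suc h'"] Suc.IH[of h'] by simp
  qed simp
qed

text \<open>For \<open>k = 0\<close> consecutive values have a ratio of absolute value
  \<open>(1/2 + h) / (h + 1) < 1\<close>; each use of Pascal's rule at most doubles the
  bound.\<close>

lemma gchoose_half_le: "\<bar>(real k - 1/2) gchoose h\<bar> \<le> 2 ^ k"
proof (induction k arbitrary: h)
  case 0
  have "\<bar>(- 1/2 :: real) gchoose h\<bar> \<le> 1"
  proof (induction h)
    case (Suc h)
    have "real (Suc h) * ((- 1/2 :: real) gchoose Suc h) = - (1/2 + real h) * ((- 1/2) gchoose h)"
      using gbinomial_mult_1[of "- 1/2 :: real" h] by (simp add: algebra_simps)
    then have "real (Suc h) * \<bar>(- 1/2 :: real) gchoose Suc h\<bar> = (1/2 + real h) * \<bar>(- 1/2) gchoose h\<bar>"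
      by (metis abs_mult abs_minus_cancel abs_of_nonneg add_nonneg_nonneg of_nat_0_le_iff zero_le_divide_1_iff zero_le_numeral)
    also have "\<dots> \<le> (1/2 + real h) * 1" by (intro mult_left_mono Suc) simp
    also have "\<dots> \<le> real (Suc h) * 1" by simp
    finally show ?case by (simp del: of_nat_Suc)
  qed simp
  then show ?case by simp
next
  case (Suc k)
  show ?case
  proof (cases h)
    case (Suc h')
    then show ?thesis using Suc.IH[of "Suc h'"] Suc.IH[of h'] unfolding Suc gchoose_half_Suc by simp
  next
    case 0
    then show ?thesis using one_le_power[of "2::real" "Suc k"] by simp
  qed
qed

text \<open>This is the coefficient in the derivative of order \<open>3 * k - 1\<close>, the order
  of a divided difference at three nodes of multiplicity \<open>k\<close>. Raising \<open>k\<close>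
  by one multiplies it by a rational function \<open>q\<close> of \<open>k\<close> that lies between
  \<open>1/16\<close> and \<open>1\<close>.\<close>

lemma gchoose_half_middle:
  assumes "k \<ge> 1"
  shows "(1/16) ^ k \<le> \<bar>(real k - 1/2) gchoose (3 * k - 1)\<bar> \<and> \<bar>(real k - 1/2) gchoose (3 * k - 1)\<bar> \<le> 1"
  using assms
proof (induction k rule: nat_induct_at_least)
  case base
  have "((1/2) :: real) gchoose 2 = - 1/8" by (simp add: gbinomial_prod_rev numeral_2_eq_2)
  then show ?case by (simp add: numeral_2_eq_2)
next
  case (Suc k)
  define a where "a = real k - 1/2"
  have k: "real k \<ge> 1" using Suc.hyps by simp
  define j where "j = 3 * k - 1"
  have j: "real j = 3 * real k - 1" using Suc.hyps by (simp add: j_def of_nat_diff)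
  \<comment> \<open>The passage from \<open>(a, j)\<close> to \<open>(a + 1, j + 3)\<close> takes
    two steps in the lower index and one absorption step that raises both arguments.\<close>
  have 1: "real (Suc j) * (a gchoose Suc j) = (a - real j) * (a gchoose j)"
    using gbinomial_mult_1[of a j] by (simp add: algebra_simps)
  have 2: "real (Suc (Suc j)) * (a gchoose Suc (Suc j)) = (a - real (Suc j)) * (a gchoose Suc j)"
    using gbinomial_mult_1[of a "Suc j"] by (simp add: algebra_simps)
  have 3: "real (Suc (Suc (Suc j))) * ((a + 1) gchoose Suc (Suc (Suc j))) = (a + 1) * (a gchoose Suc (Suc j))"
    using gbinomial_absorption[of "Suc (Suc j)" "a + 1"] by simp
  define q where "q = (a + 1) * (real j + 1 - a) * (real j - a) / ((real j + 1) * (real j + 2) * (real j + 3))"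
  have pos: "real j + 1 > 0" "real j + 2 > 0" "real j + 3 > 0" using k j by simp_all
  have "(a + 1) gchoose Suc (Suc (Suc j)) = q * (a gchoose j)"
  proof -
    have "a gchoose Suc j = (a - real j) * (a gchoose j) / (real j + 1)"
      using 1 pos by (simp add: field_simps)
    moreover have "a gchoose Suc (Suc j) = (a - real j - 1) * (a gchoose Suc j) / (real j + 2)"
      using 2 pos by (simp add: field_simps)
    moreover have "(a + 1) gchoose Suc (Suc (Suc j)) = (a + 1) * (a gchoose Suc (Suc j)) / (real j + 3)"
      using 3 pos by (simp add: field_simps)
    ultimately have "(a + 1) gchoose Suc (Suc (Suc j)) =
       (a + 1) * ((a - real j - 1) * ((a - real j) * (a gchoose j) / (real j + 1)) / (real j + 2)) / (real j + 3)"
      by simp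
    also have "\<dots> = q * (a gchoose j)" using pos unfolding q_def by (simp add: field_simps)
    finally show ?thesis .
  qed
  moreover have "3 * Suc k - 1 = Suc (Suc (Suc j))" using Suc.hyps by (simp add: j_def)
  moreover have "real (Suc k) - 1/2 = a + 1" by (simp add: a_def)
  ultimately have eq: "(real (Suc k) - 1/2) gchoose (3 * Suc k - 1) = q * ((real k - 1/2) gchoose (3 * k - 1))"
    by (simp add: a_def j_def)
  have den: "(real j + 1) * (real j + 2) * (real j + 3) > 0" using pos by simp
  have q1: "q \<le> 1"
  proof -
    have "(a + 1) * (real j + 1 - a) * (real j - a) \<le> (real j + 2) * (real j + 1) * (real j + 3)"
      using k unfolding j a_def by (intro mult_mono mult_nonneg_nonneg) simp_all
    then show ?thesis unfolding q_def using den by (simp add: field_simps)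
  qed
  have q2: "1/16 \<le> q"
  proof -
    \<comment> \<open>Expanding around \<open>k = 1\<close> leaves a cubic with nonnegative
      coefficients only.\<close>
    define x where "x = real k - 1"
    have x: "x \<ge> 0" using k by (simp add: x_def)
    have "16 * ((a + 1) * (real j + 1 - a) * (real j - a)) - (real j + 1) * (real j + 2) * (real j + 3)
        = 37 * x ^ 3 + 116 * x ^ 2 + 111 * x + 30"
      unfolding j a_def x_def by (simp add: power2_eq_square power3_eq_cube algebra_simps)
    also have "\<dots> \<ge> 0" using x by simp
    finally show ?thesis unfolding q_def using den by (simp add: field_simps)
  qed
  have q0: "q \<ge> 0" using q2 by simp
  show ?case
    unfolding eq abs_mult abs_of_nonneg[OF q0] power_Suc
    using Suc.IH q1 q2 q0 mult_mono[of "1/16" q "(1/16)^k" "\<bar>(real k - 1/2) gchoose (3 * k - 1)\<bar>"]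
      mult_mono[of q 1 "\<bar>(real k - 1/2) gchoose (3 * k - 1)\<bar>" 1]
    by simp
qed

text \<open>The \<open>i\<close>-th derivative of \<open>x powr (k - 1/2)\<close>; the falling
  factorial is split as a factorial times a binomial coefficient so that the Taylor coefficient can
  be read off.\<close>

definition half_power_deriv :: "nat \<Rightarrow> nat \<Rightarrow> real \<Rightarrow> real" where
  "half_power_deriv k i x = fact i * ((real k - 1/2) gchoose i) * x powr (real k - 1/2 - real i)"

lemma half_power_deriv:
  assumes "x > 0"
  shows "(half_power_deriv k i has_real_derivative half_power_deriv k (Suc i) x) (at x)"
proof -
  define a where "a = real k - 1/2"
  have "(half_power_deriv k i has_real_derivative fact i * (a gchoose i) * ((a - real i) * x powr (a - real i - 1))) (at x)"
    unfolding half_power_deriv_def[abs_def] a_def[symmetric]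
    using assms by (auto intro!: derivative_eq_intros)
  moreover have "fact i * (a gchoose i) * ((a - real i) * x powr (a - real i - 1)) = half_power_deriv k (Suc i) x"
  proof -
    have "real (Suc i) * (a gchoose Suc i) = (a - real i) * (a gchoose i)"
      using gbinomial_mult_1[of a i] by (simp add: algebra_simps)
    then have "fact i * (a gchoose i) * (a - real i) = fact (Suc i) * (a gchoose Suc i)"
      by (simp only: fact_Suc mult.assoc mult.commute mult.left_commute)
    then show ?thesis
      unfolding half_power_deriv_def a_def[symmetric]
      by (metis (no_types, lifting) diff_diff_eq mult.assoc of_nat_Suc add.commute)
  qed
  ultimately show ?thesis by simp
qed

text \<open>Below order \<open>k\<close> the exponent is a natural number plus one half. Hence at an
  integer these derivatives are rational multiples of one square root, and divided differences
  become linear forms in square roots.\<close>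

lemma half_power_deriv_sqrt:
  assumes "x > 0" "i < k"
  shows "half_power_deriv k i x = fact i * ((real k - 1/2) gchoose i) * x ^ (k - 1 - i) * sqrt x"
proof -
  obtain j where k: "k = Suc (i + j)" using assms(2) less_imp_Suc_add by blast
  have "x powr (real k - 1/2 - real i) = x powr (real j + 1/2)"
    by (rule arg_cong[where f = "(powr) x"]) (simp add: k)
  also have "\<dots> = x ^ j * sqrt x" using assms by (simp only: powr_add powr_realpow powr_half_sqrt less_imp_le)
  finally show ?thesis by (simp add: half_power_deriv_def k)
qed

subsection \<open>Divided differences\<close>

text \<open>The confluent case: with one node, the Hermite interpolant is the Taylor polynomial, and
  its top coefficient is a Taylor coefficient.\<close>

lemma hermite_single_node:
  assumes "u > 0" "r < k"
  defines "p \<equiv> (\<Sum>i\<le>r. smult (((real k - 1/2) gchoose i) * u powr (real k - 1/2 - real i)) ([:- u, 1:] ^ i))"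
  shows "degree p \<le> r" "coeff p r = ((real k - 1/2) gchoose r) * u ^ (k - 1 - r) * sqrt u"
    "i \<le> r \<Longrightarrow> poly ((pderiv ^^ i) p) u = half_power_deriv k i u"
proof -
  let ?c = "\<lambda>i. ((real k - 1/2) gchoose i) * u powr (real k - 1/2 - real i)"
  have deg: "degree ([:- u, 1:] ^ i) = i" for i by (simp add: degree_power_eq)
  show "degree p \<le> r"
    unfolding p_def by (rule degree_sum_le) (auto intro: order_trans[OF degree_smult_le] simp: deg)
  have c1: "coeff ([:- u, 1:] ^ i) r = (if i = r then 1 else 0)" if "i \<le> r" for i
  proof (cases "i = r")
    case True
    have "lead_coeff ([:- u, 1:] ^ i) = 1" by (simp add: lead_coeff_power)
    then show ?thesis using True deg by simp
  next
    case False
    then show ?thesis using that deg by (intro trans[OF coeff_eq_0]) auto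
  qed
  have "coeff p r = (\<Sum>i\<le>r. if i = r then ?c i else 0)"
    unfolding p_def coeff_sum coeff_smult by (rule sum.cong) (auto simp: c1)
  also have "\<dots> = ?c r" by simp
  also have "\<dots> = ((real k - 1/2) gchoose r) * u ^ (k - 1 - r) * sqrt u"
    using half_power_deriv_sqrt[OF assms(1,2)] by (simp add: half_power_deriv_def)
  finally show "coeff p r = ((real k - 1/2) gchoose r) * u ^ (k - 1 - r) * sqrt u" .
  assume "i \<le> r"
  have "poly ((pderiv ^^ i) p) u = (\<Sum>l\<le>r. ?c l * poly ((pderiv ^^ i) ([:- u, 1:] ^ l)) u)"
    unfolding p_def by (simp add: poly_sum higher_pderiv_sum higher_pderiv_smult del: mult_pCons_left)
  also have "\<dots> = (\<Sum>l\<le>r. if l = i then ?c i * fact i else 0)"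
    by (rule sum.cong) (auto simp: higher_pderiv_linear_power)
  also have "\<dots> = half_power_deriv k i u" using \<open>i \<le> r\<close> by (simp add: half_power_deriv_def)
  finally show "poly ((pderiv ^^ i) p) u = half_power_deriv k i u" .
qed

text \<open>The polynomial \<open>p\<close> is the Hermite interpolant of
  \<open>x powr (k - 1/2)\<close> with multiplicities \<open>m\<close>, and its top coefficient is
  the divided difference. Induction on the total weight follows the recursion for divided
  differences: each step divides by one node difference, which costs a factor \<open>D\<close> in
  the denominator and a factor 2 in size.\<close>

lemma hermite_interpolation_form:
  fixes u :: "'a \<Rightarrow> int" and m :: "'a \<Rightarrow> nat" and U :: real
  assumes "finite J" "\<And>j. j \<in> J \<Longrightarrow> 1 \<le> u j \<and> u j \<le> U" "inj_on u J"
    and D: "\<And>i j. i \<in> J \<Longrightarrow> j \<in> J \<Longrightarrow> i \<noteq> j \<Longrightarrow> u i - u j dvd D"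
    and "\<And>j. j \<in> J \<Longrightarrow> m j \<le> k" "sum m J = Suc r"
  shows "\<exists>(c :: 'a \<Rightarrow> real) (p :: real poly). (\<forall>j\<in>J. \<bar>c j\<bar> \<le> 2 ^ r * (2 * U) ^ k \<and> 4 ^ k * of_int D ^ r * c j \<in> \<int>)
      \<and> degree p \<le> r \<and> coeff p r = (\<Sum>j\<in>J. c j * sqrt (u j))
      \<and> (\<forall>j\<in>J. \<forall>i<m j. poly ((pderiv ^^ i) p) (u j) = half_power_deriv k i (u j))"
  using assms(5,6)
proof (induction r arbitrary: m rule: less_induct)
  case (less r)
  show ?case
  proof (cases "\<exists>i\<in>J. \<exists>j\<in>J. i \<noteq> j \<and> 0 < m i \<and> 0 < m j")
    case False
    \<comment> \<open>One node \<open>j\<close> carries all the weight, so the Taylor polynomial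
      there serves and the form has a single term.\<close>
    have "sum m J \<noteq> 0" using less.prems(2) by simp
    then obtain j where j: "j \<in> J" "0 < m j" by (meson gr0I sum.not_neutral_contains_not_neutral)
    have others: "m i = 0" if "i \<in> J" "i \<noteq> j" for i
    proof -
      have "\<not> (i \<noteq> j \<and> 0 < m i \<and> 0 < m j)"
        using False \<open>i \<in> J\<close> \<open>j \<in> J\<close> by (meson)
      with that j show ?thesis by simp
    qed
    have "sum m J = m j + sum m (J - {j})" by (rule sum.remove) (use assms j in auto)
    then have mj: "m j = Suc r" using others less.prems(2) by simp
    then have rk: "r < k" using less.prems(1)[OF j(1)] by simp
    have u: "1 \<le> real_of_int (u j)" "real_of_int (u j) \<le> U" using assms(2)[OF j(1)] by simp_all
    define c where "c = (\<lambda>i. if i = j then ((real k - 1/2) gchoose r) * of_int (u j) ^ (k - 1 - r) else 0)"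
    obtain p where p: "degree p \<le> r" "coeff p r = ((real k - 1/2) gchoose r) * of_int (u j) ^ (k - 1 - r) * sqrt (u j)"
      "\<And>i. i \<le> r \<Longrightarrow> poly ((pderiv ^^ i) p) (u j) = half_power_deriv k i (u j)"
      by (rule that[OF hermite_single_node[OF _ rk]]) (use u in linarith)+
    have 1: "\<bar>c j\<bar> \<le> 2 ^ r * (2 * U) ^ k"
    proof -
      have "real_of_int (u j) ^ (k - 1 - r) \<le> U ^ (k - 1 - r)" using u by (intro power_mono) auto
      also have "\<dots> \<le> U ^ k" using u by (intro power_increasing) auto
      finally have "\<bar>c j\<bar> \<le> 2 ^ k * U ^ k"
        unfolding c_def using u gchoose_half_le[of k r] by (auto simp: abs_mult intro!: mult_mono)
      also have "\<dots> \<le> 2 ^ r * (2 ^ k * U ^ k)"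
        using mult_right_mono[of 1 "2 ^ r" "2 ^ k * U ^ k"] u by simp
      finally show ?thesis by (simp add: power_mult_distrib)
    qed
    have 2: "4 ^ k * of_int D ^ r * c j \<in> \<int>"
    proof -
      \<comment> \<open>As \<open>r < k\<close>, the factor \<open>4 ^ k\<close> contains the
        \<open>4 ^ r\<close> that clears the binomial coefficient; \<open>D ^ r\<close> is merely an
        integer surplus.\<close>
      have "(4::real) ^ k = 4 ^ (k - r) * 4 ^ r" using rk by (subst power_add[symmetric]) simp
      then have "4 ^ k * of_int D ^ r * c j
          = 4 ^ (k - r) * of_int D ^ r * of_int (u j) ^ (k - 1 - r) * (4 ^ r * ((real k - 1/2) gchoose r))"
        unfolding c_def by simp
      also have "\<dots> \<in> \<int>" by (intro Ints_mult[OF _ gchoose_half_int]) simp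
      finally show ?thesis .
    qed
    have 3: "(\<Sum>i\<in>J. c i * sqrt (u i)) = c j * sqrt (u j)"
      by (subst sum.remove[OF assms(1) j(1)]) (simp add: c_def)
    have U0: "U \<ge> 0" using u by linarith
    show ?thesis
    proof (intro exI[of _ c] exI[of _ p] conjI ballI allI impI)
      fix i assume i: "i \<in> J"
      show "\<bar>c i\<bar> \<le> 2 ^ r * (2 * U) ^ k" using 1 U0 by (cases "i = j") (simp_all add: c_def)
      show "4 ^ k * of_int D ^ r * c i \<in> \<int>" using 2 by (cases "i = j") (simp_all add: c_def)
    next
      fix i l assume i: "i \<in> J" and l: "l < m i"
      then have "i = j" using others by fastforce
      then show "poly ((pderiv ^^ l) p) (u i) = half_power_deriv k l (u i)" using p(3) l mj by simp
    qed (use p(1,2) 3 in \<open>simp_all add: c_def\<close>)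
  next
    case True
    then obtain i j where ij: "i \<in> J" "j \<in> J" "i \<noteq> j" "0 < m i" "0 < m j" by (elim bexE conjE)
    have sumij: "sum m J = m i + (m j + sum m (J - {i} - {j}))"
      using ij assms(1) by (simp add: sum.remove[of J i] sum.remove[of "J - {i}" j])
    then obtain r' where r': "r = Suc r'" using less.prems(2) ij by (cases r) auto
    have upd: "sum (m(l := m l - 1)) J = Suc r'" if "l \<in> J" "0 < m l" for l
    proof -
      have "sum (m(l := m l - 1)) J = (m l - 1) + sum m (J - {l})"
        using that assms(1) by (simp add: sum.remove[of J l])
      moreover have "sum m J = m l + sum m (J - {l})" using that assms(1) by (simp add: sum.remove[of J l])
      ultimately show ?thesis using that less.prems(2) r' by simp
    qed
    have ex: "\<exists>(c :: 'a \<Rightarrow> real) (p :: real poly). (\<forall>j\<in>J. \<bar>c j\<bar> \<le> 2 ^ r' * (2 * U) ^ k \<and> 4 ^ k * of_int D ^ r' * c j \<in> \<int>)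
      \<and> degree p \<le> r' \<and> coeff p r' = (\<Sum>j\<in>J. c j * sqrt (u j))
      \<and> (\<forall>j\<in>J. \<forall>i<(m(l := m l - 1)) j. poly ((pderiv ^^ i) p) (u j) = half_power_deriv k i (u j))"
      if "l \<in> J" "0 < m l" for l
      by (rule less.IH) (use r' upd[OF that] less.prems(1) in \<open>auto intro: diff_le_self le_trans\<close>)
    obtain c p where c0: "\<forall>l\<in>J. \<bar>c l\<bar> \<le> 2 ^ r' * (2 * U) ^ k \<and> 4 ^ k * of_int D ^ r' * c l \<in> \<int>"
      and deg_p: "degree p \<le> r'" and lead_p: "coeff p r' = (\<Sum>j\<in>J. c j * sqrt (u j))"
      and p0: "\<forall>l\<in>J. \<forall>s<(m(i := m i - 1)) l. poly ((pderiv ^^ s) p) (u l) = half_power_deriv k s (u l)"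
      using ex[OF ij(1) ij(4)] by (elim exE conjE)
    have c: "\<bar>c l\<bar> \<le> 2 ^ r' * (2 * U) ^ k" "4 ^ k * of_int D ^ r' * c l \<in> \<int>" if "l \<in> J" for l
      using c0 that by simp_all
    have p: "poly ((pderiv ^^ s) p) (u l) = half_power_deriv k s (u l)"
      if "l \<in> J" "s < (m(i := m i - 1)) l" for l s
      using bspec[OF p0 that(1)] that(2) by (elim allE impE)
    obtain d q where d0: "\<forall>l\<in>J. \<bar>d l\<bar> \<le> 2 ^ r' * (2 * U) ^ k \<and> 4 ^ k * of_int D ^ r' * d l \<in> \<int>"
      and deg_q: "degree q \<le> r'" and lead_q: "coeff q r' = (\<Sum>j\<in>J. d j * sqrt (u j))"
      and q0: "\<forall>l\<in>J. \<forall>s<(m(j := m j - 1)) l. poly ((pderiv ^^ s) q) (u l) = half_power_deriv k s (u l)"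
      using ex[OF ij(2) ij(5)] by (elim exE conjE)
    have d: "\<bar>d l\<bar> \<le> 2 ^ r' * (2 * U) ^ k" "4 ^ k * of_int D ^ r' * d l \<in> \<int>" if "l \<in> J" for l
      using d0 that by simp_all
    have q: "poly ((pderiv ^^ s) q) (u l) = half_power_deriv k s (u l)"
      if "l \<in> J" "s < (m(j := m j - 1)) l" for l s
      using bspec[OF q0 that(1)] that(2) by (elim allE impE)
    text \<open>Aitken--Neville: interpolants with one node weight lowered are glued by linear factors.\<close>
    define \<delta> where "\<delta> = u j - u i"
    have "\<delta> \<noteq> 0" using ij assms(3) by (auto simp: \<delta>_def inj_on_def)
    then have \<delta>1: "1 \<le> \<bar>real_of_int \<delta>\<bar>" by linarith
    obtain e where e: "D = \<delta> * e" using D[OF ij(2,1)] ij(3) by (auto simp: \<delta>_def)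
    have lin: "pderiv [:- v, 1:] = (1 :: real poly)" for v by (simp add: pderiv_pCons)
    define c' where "c' l = (c l - d l) / \<delta>" for l
    define p' where "p' = smult (1 / \<delta>) ([:- real_of_int (u i), 1:] * p - [:- real_of_int (u j), 1:] * q)"
    have coeff_lin: "coeff ([:- v, 1:] * f) (Suc r') = coeff f r'" if "degree f \<le> r'" for v and f :: "real poly"
      using that by (simp add: coeff_eq_0)
    show ?thesis
    proof (intro exI[of _ c'] exI[of _ p'] conjI ballI allI impI)
      fix l assume l: "l \<in> J"
      have "\<bar>c' l\<bar> \<le> \<bar>c l - d l\<bar>"
        unfolding c'_def abs_divide using \<delta>1 divide_left_mono[OF \<delta>1, of "\<bar>c l - d l\<bar>"] by simp
      also have "\<dots> \<le> 2 ^ r' * (2 * U) ^ k + 2 ^ r' * (2 * U) ^ k"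
        using c(1)[OF l] d(1)[OF l] by linarith
      also have "\<dots> = 2 ^ r * (2 * U) ^ k" by (simp add: r')
      finally show "\<bar>c' l\<bar> \<le> 2 ^ r * (2 * U) ^ k" .
      have "4 ^ k * of_int D ^ r * c' l = of_int e * (4 ^ k * of_int D ^ r' * c l) - of_int e * (4 ^ k * of_int D ^ r' * d l)"
      proof -
        have "of_int D * c' l = of_int e * (c l - d l)"
          unfolding c'_def e using \<open>\<delta> \<noteq> 0\<close> by simp
        moreover have "4 ^ k * of_int D ^ r * c' l = 4 ^ k * of_int D ^ r' * (of_int D * c' l)"
          by (simp add: r')
        ultimately show ?thesis by (simp only: right_diff_distrib mult.left_commute)
      qed
      also have "\<dots> \<in> \<int>" by (intro Ints_diff Ints_mult c(2) d(2) l) simp_all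
      finally show "4 ^ k * of_int D ^ r * c' l \<in> \<int>" .
    next
      have deg: "degree ([:- v, 1:] * f) \<le> Suc r'" if "degree f \<le> r'" for v and f :: "real poly"
        by (rule order_trans[OF degree_mult_le]) (use that in simp)
      show "degree p' \<le> r"
        unfolding p'_def r' by (intro order_trans[OF degree_smult_le] degree_diff_le deg deg_p deg_q)
      have "coeff p' r = (coeff p r' - coeff q r') / \<delta>"
        unfolding p'_def r' coeff_smult coeff_diff coeff_lin[OF deg_p] coeff_lin[OF deg_q] by simp
      also have "\<dots> = (\<Sum>j\<in>J. c' j * sqrt (u j))"
        unfolding lead_p lead_q c'_def sum_subtractf[symmetric] sum_divide_distrib
        by (rule sum.cong) (simp_all add: left_diff_distrib diff_divide_distrib)
      finally show "coeff p' r = (\<Sum>j\<in>J. c' j * sqrt (u j))" .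
    next
      fix l s assume l: "l \<in> J" and s: "s < m l"
      let ?h = "\<lambda>s. half_power_deriv k s (u l)"
      \<comment> \<open>Multiplying by the linear factor of node \<open>x\<close> restores the
        weight that had been lowered there: at that node the unknown derivative of order
        \<open>m x - 1\<close> is multiplied by zero. Both products therefore match the function
        times their linear factor, and their difference is \<open>\<delta>\<close> times the
        function.\<close>
      have gen: "poly ((pderiv ^^ s) ([:- real_of_int (u x), 1:] * f)) (u l) = (real_of_int (u l) - real_of_int (u x)) * ?h s + real s * ?h (s - 1)"
        if f: "\<And>s. s < (m(x := m x - 1)) l \<Longrightarrow> poly ((pderiv ^^ s) f) (u l) = ?h s" and x: "0 < m x"
        for f x
      proof -
        have "poly ((pderiv ^^ s) ([:- real_of_int (u x), 1:] * f)) (u l)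
           = (real_of_int (u l) - real_of_int (u x)) * poly ((pderiv ^^ s) f) (u l) + real s * poly ((pderiv ^^ (s - 1)) f) (u l)"
          by (subst higher_pderiv_linear_mult[OF lin]) (simp add: left_diff_distrib)
        moreover have "(real_of_int (u l) - real_of_int (u x)) * poly ((pderiv ^^ s) f) (u l) = (real_of_int (u l) - real_of_int (u x)) * ?h s"
        proof (cases "x = l")
          case False
          then have "s < (m(x := m x - 1)) l" using s by simp
          from f[OF this] show ?thesis by simp
        qed simp
        moreover have "real s * poly ((pderiv ^^ (s - 1)) f) (u l) = real s * ?h (s - 1)"
        proof (cases "s = 0")
          case False
          then have "s - 1 < (m(x := m x - 1)) l" using s by (cases "x = l") simp_all
          from f[OF this] show ?thesis by simp
        qed simp
        ultimately show ?thesis by (simp only:)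
      qed
      have gi: "poly ((pderiv ^^ s) ([:- real_of_int (u i), 1:] * p)) (u l)
          = (real_of_int (u l) - real_of_int (u i)) * ?h s + real s * ?h (s - 1)"
        by (rule gen) (use p[OF l] ij in auto)
      have gj: "poly ((pderiv ^^ s) ([:- real_of_int (u j), 1:] * q)) (u l)
          = (real_of_int (u l) - real_of_int (u j)) * ?h s + real s * ?h (s - 1)"
        by (rule gen) (use q[OF l] ij in auto)
      have higher_diff: "(pderiv ^^ s) (f - g) = (pderiv ^^ s) f - (pderiv ^^ s) g" for f g :: "real poly"
        by (induction s) (simp_all add: pderiv_diff)
      have "poly ((pderiv ^^ s) p') (u l)
        = (((real_of_int (u l) - real_of_int (u i)) * ?h s + real s * ?h (s - 1))
          - ((real_of_int (u l) - real_of_int (u j)) * ?h s + real s * ?h (s - 1))) / \<delta>"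
        unfolding gi[symmetric] gj[symmetric] p'_def
        by (simp only: higher_pderiv_smult higher_diff poly_smult poly_diff) simp
      also have "\<dots> = ?h s" using \<open>\<delta> \<noteq> 0\<close> by (simp add: \<delta>_def field_simps)
      finally show "poly ((pderiv ^^ s) p') (u l) = half_power_deriv k s (u l)" .
    qed
  qed
qed

text \<open>Three nodes of multiplicity \<open>k\<close> make the form a divided difference of order
  \<open>3 * k - 1\<close>. By Rolle it equals a Taylor coefficient at some \<open>\<xi>\<close> in
  \<open>{L..U}\<close>, which bounds it from both sides; in particular it is nonzero.\<close>

lemma small_linear_form:
  fixes u :: "nat \<Rightarrow> int" and L U :: real
  assumes "k \<ge> 1" "\<And>j. j < 3 \<Longrightarrow> 1 \<le> u j \<and> L \<le> u j \<and> u j \<le> U" "0 < L"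
    and "u 0 \<noteq> u 1" "u 0 \<noteq> u 2" "u 1 \<noteq> u 2"
  defines "D \<equiv> (u 0 - u 1) * (u 0 - u 2) * (u 1 - u 2)"
  shows "\<exists>c :: nat \<Rightarrow> real. (\<forall>j<3. \<bar>c j\<bar> \<le> (16 * U) ^ k \<and> 4 ^ k * of_int D ^ (3 * k) * c j \<in> \<int>)
     \<and> (1/16) ^ k * sqrt U / U ^ (2 * k) \<le> \<bar>\<Sum>j<3. c j * sqrt (u j)\<bar>
     \<and> \<bar>\<Sum>j<3. c j * sqrt (u j)\<bar> \<le> sqrt L / L ^ (2 * k)"
proof -
  define r where "r = 3 * k - 1"
  have r: "Suc r = 3 * k" using assms(1) by (simp add: r_def)
  have three: "{..<3::nat} = {0, 1, 2}" by auto
  have U1: "1 \<le> U" using assms(2)[of 0] by linarith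
  have dvd: "u i - u j dvd D" if "i \<in> {..<3}" "j \<in> {..<3}" "i \<noteq> j" for i j
  proof -
    have 1: "u 0 - u 1 dvd D" "u 0 - u 2 dvd D" "u 1 - u 2 dvd D" by (simp_all add: D_def)
    then have 2: "u 1 - u 0 dvd D" "u 2 - u 0 dvd D" "u 2 - u 1 dvd D"
      by (metis minus_diff_eq minus_dvd_iff)+
    show ?thesis using that 1 2 unfolding three by auto
  qed
  have "inj_on u {..<3}" unfolding three using assms(4-6) by (auto simp: inj_on_def)
  then have "\<exists>(c :: nat \<Rightarrow> real) (p :: real poly). (\<forall>j\<in>{..<3}. \<bar>c j\<bar> \<le> 2 ^ r * (2 * U) ^ k \<and> 4 ^ k * of_int D ^ r * c j \<in> \<int>)
      \<and> degree p \<le> r \<and> coeff p r = (\<Sum>j<3. c j * sqrt (u j))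
      \<and> (\<forall>j\<in>{..<3}. \<forall>i<k. poly ((pderiv ^^ i) p) (u j) = half_power_deriv k i (u j))"
    using assms(2) dvd r by (intro hermite_interpolation_form) simp_all
  then obtain c :: "nat \<Rightarrow> real" and p :: "real poly"
    where c: "\<forall>j\<in>{..<3}. \<bar>c j\<bar> \<le> 2 ^ r * (2 * U) ^ k \<and> 4 ^ k * of_int D ^ r * c j \<in> \<int>"
      and deg: "degree p \<le> r" and lead: "coeff p r = (\<Sum>j<3. c j * sqrt (u j))"
      and p: "\<forall>j\<in>{..<3}. \<forall>i<k. poly ((pderiv ^^ i) p) (u j) = half_power_deriv k i (u j)"
    by (elim exE conjE)
  define f where "f i x = half_power_deriv k i x - poly ((pderiv ^^ i) p) x" for i x
  \<comment> \<open>The interpolation error has \<open>3 * k = r + 1\<close> zeros counted with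
    multiplicity.\<close>
  have "\<exists>\<xi>\<in>{L..U}. f r \<xi> = 0"
  proof (rule generalised_rolle[where w = "\<lambda>_. k" and Z = "(\<lambda>j. real_of_int (u j)) ` {..<3}"])
    show "(f i has_real_derivative f (Suc i) x) (at x)" if "x \<in> {L..U}" for i x
      unfolding f_def[abs_def] using that assms(3)
      by (auto intro!: derivative_eq_intros half_power_deriv)
    have "card ((\<lambda>j. real_of_int (u j)) ` {..<3}) = 3"
      unfolding three using assms(4-6) by auto
    then show "r < (\<Sum>_\<in>(\<lambda>j. real_of_int (u j)) ` {..<3}. k)" using r by simp
  qed (use assms(2) p in \<open>auto simp: f_def\<close>)
  then obtain \<xi> where \<xi>: "L \<le> \<xi>" "\<xi> \<le> U" "f r \<xi> = 0" by auto
  let ?g = "(real k - 1/2) gchoose (3 * k - 1)"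
  have "fact r * (\<Sum>j<3. c j * sqrt (u j)) = fact r * ?g * \<xi> powr (real k - 1/2 - real r)"
    using \<xi>(3) poly_higher_pderiv_degree_le[OF deg] lead
    by (simp add: f_def half_power_deriv_def r_def)
  then have "(\<Sum>j<3. c j * sqrt (u j)) = ?g * \<xi> powr (real k - 1/2 - real r)" by simp
  \<comment> \<open>The exponent is \<open>k - 1/2 - (3 * k - 1) = 1/2 - 2 * k\<close>; it is
    negative, so the extremes occur at the ends of \<open>{L..U}\<close>.\<close>
  moreover have powr: "x powr (real k - 1/2 - real r) = sqrt x / x ^ (2 * k)" if "0 < x" for x :: real
  proof -
    have "x powr (real k - 1/2 - real r) = x powr (1/2 - real (2 * k))"
      by (rule arg_cong[where f = "(powr) x"]) (use assms(1) in \<open>simp add: r_def of_nat_diff\<close>)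
    then show ?thesis using that by (simp only: powr_diff powr_realpow powr_half_sqrt less_imp_le)
  qed
  ultimately have form: "\<bar>\<Sum>j<3. c j * sqrt (u j)\<bar> = \<bar>?g\<bar> * \<xi> powr (real k - 1/2 - real r)"
    by (simp add: abs_mult)
  have neg: "real k - 1/2 - real r \<le> 0" using assms(1) by (simp add: r_def of_nat_diff)
  have hi: "\<xi> powr (real k - 1/2 - real r) \<le> sqrt L / L ^ (2 * k)"
    unfolding powr[OF assms(3), symmetric] using \<xi> assms(3) neg by (intro powr_mono2') auto
  have lo: "sqrt U / U ^ (2 * k) \<le> \<xi> powr (real k - 1/2 - real r)"
    using \<xi> assms(3) neg U1 by (subst powr[symmetric]) (auto intro!: powr_mono2')
  note g = gchoose_half_middle[OF assms(1)]
  show ?thesis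
  proof (intro exI[of _ c] conjI allI impI)
    fix j :: nat assume j: "j < 3"
    have "2 ^ r * (2 * U) ^ k \<le> 2 ^ (3 * k) * (2 * U) ^ k"
      using U1 by (intro mult_right_mono power_increasing) (auto simp: r_def)
    also have "\<dots> = (8 * (2 * U)) ^ k" unfolding power_mult power_mult_distrib by simp
    finally have "2 ^ r * (2 * U) ^ k \<le> (16 * U) ^ k" by simp
    moreover have "\<bar>c j\<bar> \<le> 2 ^ r * (2 * U) ^ k" using c j by simp
    ultimately show "\<bar>c j\<bar> \<le> (16 * U) ^ k" by linarith
    have "of_int D * (4 ^ k * of_int D ^ r * c j) \<in> \<int>"
      by (rule Ints_mult) (use c j in simp_all)
    moreover have "of_int D * (4 ^ k * of_int D ^ r * c j) = 4 ^ k * of_int D ^ (3 * k) * c j"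
      unfolding r[symmetric] power_Suc by (simp only: mult_ac)
    ultimately show "4 ^ k * of_int D ^ (3 * k) * c j \<in> \<int>" by (simp only:)
  next
    show "(1/16) ^ k * sqrt U / U ^ (2 * k) \<le> \<bar>\<Sum>j<3. c j * sqrt (u j)\<bar>"
      unfolding form times_divide_eq_right[symmetric]
      using g lo U1 by (intro mult_mono) (auto simp del: power_one_over)
    have "\<bar>?g\<bar> * \<xi> powr (real k - 1/2 - real r) \<le> 1 * (sqrt L / L ^ (2 * k))"
      using g hi by (intro mult_mono) auto
    then show "\<bar>\<Sum>j<3. c j * sqrt (u j)\<bar> \<le> sqrt L / L ^ (2 * k)" unfolding form by simp
  qed
qed

subsection \<open>Simultaneous approximation of square roots\<close>

lemma abs_sqrt_diff_le:
  fixes v w n :: real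
  assumes "0 \<le> v" "0 < w" "w + n = v\<^sup>2"
  shows "\<bar>v - sqrt w\<bar> \<le> \<bar>n\<bar> / sqrt w"
proof -
  have "(v - sqrt w) * (v + sqrt w) = n"
    using assms by (simp add: algebra_simps power2_eq_square)
  then have "\<bar>v - sqrt w\<bar> * (v + sqrt w) = \<bar>n\<bar>"
    using assms by (metis abs_mult abs_of_nonneg add_nonneg_nonneg less_imp_le real_sqrt_ge_zero)
  moreover have "\<bar>v - sqrt w\<bar> * sqrt w \<le> \<bar>v - sqrt w\<bar> * (v + sqrt w)"
    using assms by (intro mult_left_mono) auto
  ultimately show ?thesis using assms by (simp add: pos_le_divide_eq)
qed

text \<open>With $p_j = \rho \sqrt{u_j} + \varepsilon_j$, the hypothesis \<open>large\<close> makes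
  $\rho\sum_j c_j \sqrt{u_j}$ dominate the error term, so $\sum_j c_j p_j$ is nonzero and, in contrast
  to the usual argument, no determinant of approximants has to be computed; \<open>small\<close> bounds the
  integer obtained by clearing denominators below $1$.\<close>

lemma no_simultaneous_approximation:
  fixes u p :: "nat \<Rightarrow> int" and \<rho> \<epsilon> L U :: real
  assumes "k \<ge> 1" "\<And>j. j < 3 \<Longrightarrow> 1 \<le> u j \<and> L \<le> u j \<and> u j \<le> U" "0 < L"
    and "u 0 \<noteq> u 1" "u 0 \<noteq> u 2" "u 1 \<noteq> u 2" "0 < \<rho>"
    and p: "\<And>j. j < 3 \<Longrightarrow> \<bar>p j - \<rho> * sqrt (u j)\<bar> \<le> \<epsilon>"
    and large: "3 * (16 * U) ^ k * \<epsilon> < \<rho> * ((1/16) ^ k * sqrt U / U ^ (2 * k))"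
    and small: "2 * \<rho> * (sqrt L / L ^ (2 * k)) * (4 ^ k * real_of_int \<bar>(u 0 - u 1) * (u 0 - u 2) * (u 1 - u 2)\<bar> ^ (3 * k)) \<le> 1"
  shows False
proof -
  define D where "D = (u 0 - u 1) * (u 0 - u 2) * (u 1 - u 2)"
  obtain c :: "nat \<Rightarrow> real" where c: "\<forall>j<3. \<bar>c j\<bar> \<le> (16 * U) ^ k \<and> 4 ^ k * of_int D ^ (3 * k) * c j \<in> \<int>"
    and lower: "(1/16) ^ k * sqrt U / U ^ (2 * k) \<le> \<bar>\<Sum>j<3. c j * sqrt (u j)\<bar>"
    and upper: "\<bar>\<Sum>j<3. c j * sqrt (u j)\<bar> \<le> sqrt L / L ^ (2 * k)"
    using small_linear_form[of k u L U, OF assms(1) _ assms(3-6)] assms(2)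
    unfolding D_def[symmetric] by auto
  define \<Lambda> where "\<Lambda> = (\<Sum>j<3. c j * sqrt (u j))"
  define X where "X = (\<Sum>j<3. c j * p j)"
  define Q :: real where "Q = 4 ^ k * of_int D ^ (3 * k)"
  have D0: "D \<noteq> 0" using assms(4-6) by (simp add: D_def)
  have U0: "0 < U" using assms(2)[of 0] by linarith
  have err: "\<bar>X - \<rho> * \<Lambda>\<bar> \<le> 3 * (16 * U) ^ k * \<epsilon>"
  proof -
    have "X - \<rho> * \<Lambda> = (\<Sum>j<3. c j * (p j - \<rho> * sqrt (u j)))"
      unfolding X_def \<Lambda>_def sum_distrib_left sum_subtractf[symmetric]
      by (rule sum.cong) (simp_all add: algebra_simps)
    also have "\<bar>\<dots>\<bar> \<le> (\<Sum>j<(3::nat). (16 * U) ^ k * \<epsilon>)"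
    proof (rule order_trans[OF sum_abs sum_mono])
      fix j :: nat assume "j \<in> {..<3}"
      then show "\<bar>c j * (p j - \<rho> * sqrt (u j))\<bar> \<le> (16 * U) ^ k * \<epsilon>"
        unfolding abs_mult using c p[of j] U0 by (intro mult_mono) auto
    qed
    also have "\<dots> = 3 * (16 * U) ^ k * \<epsilon>" by simp
    finally show ?thesis .
  qed
  have "\<rho> * ((1/16) ^ k * sqrt U / U ^ (2 * k)) \<le> \<rho> * \<bar>\<Lambda>\<bar>"
    using lower assms(7) unfolding \<Lambda>_def by (intro mult_left_mono) auto
  \<comment> \<open>The strict inequality serves twice: it makes \<open>X\<close> nonzero and bounds
    \<open>\<bar>X\<bar>\<close> by twice the main term.\<close>
  then have lt: "\<bar>X - \<rho> * \<Lambda>\<bar> < \<bar>\<rho> * \<Lambda>\<bar>" using err large assms(7) by (simp add: abs_mult)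
  have "Q * X \<in> \<int>"
  proof -
    have "Q * X = (\<Sum>j<3. Q * c j * p j)" unfolding X_def sum_distrib_left by (simp only: mult.assoc)
    also have "\<dots> \<in> \<int>"
      by (intro Ints_sum Ints_mult[of "Q * c j" "of_int (p j)" for j]) (use c in \<open>simp_all add: Q_def\<close>)
    finally show ?thesis .
  qed
  moreover have "Q * X \<noteq> 0" using lt D0 by (auto simp: Q_def)
  ultimately have ge: "1 \<le> \<bar>Q * X\<bar>" by (rule Ints_nonzero_abs_ge1)
  have Q0: "0 < \<bar>Q\<bar>" using D0 by (simp add: Q_def)
  have "\<bar>X\<bar> < 2 * \<bar>\<rho> * \<Lambda>\<bar>" using lt by linarith
  also have "\<dots> \<le> 2 * \<rho> * (sqrt L / L ^ (2 * k))"
    using upper assms(7) by (simp add: abs_mult \<Lambda>_def del: times_divide_eq_right)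
  finally have "\<bar>X\<bar> * \<bar>Q\<bar> < 2 * \<rho> * (sqrt L / L ^ (2 * k)) * \<bar>Q\<bar>"
    using Q0 by (rule mult_strict_right_mono)
  also have "\<dots> \<le> 1" using small by (simp add: Q_def D_def abs_mult power_abs)
  finally show False using ge by (simp add: abs_mult mult.commute)
qed

text \<open>Apply the preceding criterion with \<open>L = N / 2\<close>, \<open>U = 2 * N\<close>
  and \<open>\<rho> = sqrt (a * b * d)\<close>. Then \<open>low\<close> says that the error is
  dominated by the form, and \<open>high\<close> that the cleared integer is below one. The
  condition \<open>2 * \<bar>n\<bar> \<le> a * c\<close> keeps the nodes within a factor 2 of
  \<open>N\<close>.\<close>

lemma no_square_triple_in_range:
  fixes n a b c d s t x y z :: int
  defines "N \<equiv> real_of_int (a * b * c)"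
  assumes "n \<noteq> 0" "0 < a" "a < b" "b < c" "0 < d" "2 * \<bar>n\<bar> \<le> a * c" "k \<ge> 1"
    and s: "a * c + n = s\<^sup>2" "0 \<le> s" and t: "b * c + n = t\<^sup>2" "0 \<le> t"
    and x: "a * d + n = x\<^sup>2" "0 \<le> x" and y: "b * d + n = y\<^sup>2" "0 \<le> y" and z: "c * d + n = z\<^sup>2" "0 \<le> z"
    and low: "3 * 2048 ^ k * N ^ (3 * k + 1) < d"
    and high: "2 * sqrt d * N * (16 * real_of_int (\<bar>n\<bar> * b) ^ 9) ^ k \<le> N ^ (2 * k)"
  shows False
proof -
  define u where "u = (\<lambda>j::nat. if j = 0 then a * b * c else if j = 1 then b * s\<^sup>2 else a * t\<^sup>2)"
  define p where "p = (\<lambda>j::nat. if j = 0 then a * b * z else if j = 1 then b * s * x else a * t * y)"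
  have b0: "0 < b" "1 \<le> a" "1 \<le> b" "1 \<le> c" using assms by simp_all
  have ab1: "1 \<le> a * b" using b0 mult_mono[of 1 a 1 b] by simp
  have u: "u 0 = a * b * c" "u 1 = a * b * c + n * b" "u 2 = a * b * c + n * a"
    by (simp_all add: u_def s(1)[symmetric] t(1)[symmetric] algebra_simps)
  have nb: "2 * (\<bar>n\<bar> * b) \<le> a * b * c"
    using mult_right_mono[OF assms(7), of b] b0 by (simp add: algebra_simps)
  have na: "\<bar>n\<bar> * a \<le> \<bar>n\<bar> * b" using assms by (intro mult_left_mono) auto
  have "\<bar>n * b\<bar> = \<bar>n\<bar> * b" "\<bar>n * a\<bar> = \<bar>n\<bar> * a" using assms b0 by (simp_all add: abs_mult)
  then have u_range: "a * b * c \<le> 2 * u j \<and> u j \<le> 2 * (a * b * c)" if "j < 3" for j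
  proof -
    have "j = 0 \<or> j = 1 \<or> j = 2" using that by linarith
    then show ?thesis using u nb na \<open>\<bar>n * b\<bar> = _\<close> \<open>\<bar>n * a\<bar> = _\<close> by (elim disjE) (hypsubst; linarith)+
  qed
  have abc1: "1 \<le> a * b * c" using ab1 b0 mult_mono[of 1 "a * b" 1 c] by simp
  then have N1: "1 \<le> N" unfolding N_def by linarith
  have dist: "u 0 \<noteq> u 1" "u 0 \<noteq> u 2" "u 1 \<noteq> u 2" unfolding u using assms by auto
  \<comment> \<open>The node differences are, up to sign, \<open>n * b\<close>, \<open>n * a\<close>
    and \<open>n * (b - a)\<close>; they do not involve \<open>c\<close>, which is what makes the
    denominators small compared with \<open>N\<close>.\<close>
  have D: "\<bar>(u 0 - u 1) * (u 0 - u 2) * (u 1 - u 2)\<bar> \<le> (\<bar>n\<bar> * b) ^ 3"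
  proof -
    have "\<bar>(u 0 - u 1) * (u 0 - u 2) * (u 1 - u 2)\<bar> = (\<bar>n\<bar> * b) * (\<bar>n\<bar> * a) * (\<bar>n\<bar> * (b - a))"
      unfolding u using assms b0 by (simp add: abs_mult right_diff_distrib[symmetric])
    also have "\<dots> \<le> (\<bar>n\<bar> * b) * (\<bar>n\<bar> * b) * (\<bar>n\<bar> * b)"
      using assms b0 by (intro mult_mono mult_left_mono) auto
    finally show ?thesis by (simp add: power3_eq_cube)
  qed
  have rr: "0 < real_of_int a" "0 < real_of_int b" "0 < real_of_int c" "0 < real_of_int d"
    "1 \<le> real_of_int a" "1 \<le> real_of_int b" "1 \<le> real_of_int c" "real_of_int a \<le> b" "real_of_int b \<le> c"
    using assms b0 by simp_all
  define \<rho> where "\<rho> = sqrt (a * b * d)"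
  define \<epsilon> where "\<epsilon> = N * sqrt N / sqrt d"
  have \<rho>u: "\<rho> * sqrt (u 0) = a * b * sqrt (c * d)" "\<rho> * sqrt (u 1) = b * s * sqrt (a * d)"
    "\<rho> * sqrt (u 2) = a * t * sqrt (b * d)"
  proof -
    have "\<rho> * sqrt (u 0) = sqrt ((a * b)\<^sup>2 * (c * d))"
      unfolding \<rho>_def real_sqrt_mult[symmetric] u_def by (simp add: power2_eq_square algebra_simps)
    also have "\<dots> = a * b * sqrt (c * d)"
      using rr by (simp add: real_sqrt_mult)
    finally show "\<rho> * sqrt (u 0) = a * b * sqrt (c * d)" .
    have "\<rho> * sqrt (u 1) = sqrt ((b * s)\<^sup>2 * (a * d))"
      unfolding \<rho>_def real_sqrt_mult[symmetric] u_def by (simp add: power2_eq_square algebra_simps)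
    also have "\<dots> = b * s * sqrt (a * d)"
      using rr s by (simp add: real_sqrt_mult)
    finally show "\<rho> * sqrt (u 1) = b * s * sqrt (a * d)" .
    have "\<rho> * sqrt (u 2) = sqrt ((a * t)\<^sup>2 * (b * d))"
      unfolding \<rho>_def real_sqrt_mult[symmetric] u_def by (simp add: power2_eq_square algebra_simps)
    also have "\<dots> = a * t * sqrt (b * d)"
      using rr t by (simp add: real_sqrt_mult)
    finally show "\<rho> * sqrt (u 2) = a * t * sqrt (b * d)" .
  qed
  have close: "\<bar>real_of_int v - sqrt (g * d)\<bar> \<le> \<bar>n\<bar> / sqrt (g * d)"
    if "g * d + n = v\<^sup>2" "0 \<le> v" "0 < g" for v g :: int
  proof (unfold of_int_abs, rule abs_sqrt_diff_le)
    show "real_of_int (g * d) + real_of_int n = (real_of_int v)\<^sup>2"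
      using that(1) by (metis of_int_add of_int_power)
  qed (use that assms in auto)
  have eps: "\<bar>p j - \<rho> * sqrt (u j)\<bar> \<le> \<epsilon>" if "j < 3" for j
  proof -
    \<comment> \<open>Squaring turns each of the three error bounds into an inequality between
      integers.\<close>
    have main: "real_of_int m * (\<bar>n\<bar> / sqrt (g * d)) \<le> \<epsilon>"
      if m: "0 \<le> m" and g: "0 < g" and le: "(m * \<bar>n\<bar>)\<^sup>2 \<le> (a * b * c) ^ 3 * g" for m g :: int
    proof -
      have "real_of_int m * \<bar>n\<bar> = sqrt (real_of_int ((m * \<bar>n\<bar>)\<^sup>2))" using m by simp
      also have "\<dots> \<le> sqrt (real_of_int ((a * b * c) ^ 3 * g))" using le by (simp only: real_sqrt_le_iff of_int_le_iff)
      also have "\<dots> = N * sqrt N * sqrt g"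
        using N1 by (simp add: N_def power3_eq_cube real_sqrt_mult)
      finally show ?thesis
        using rr g by (simp add: \<epsilon>_def real_sqrt_mult divide_simps)
    qed
    have n_le: "\<bar>n\<bar> * 2 \<le> a * c" "\<bar>n\<bar> * b * 2 \<le> a * b * c" using assms(7) nb by simp_all
    have sqn: "(\<bar>n\<bar> * b)\<^sup>2 * 4 \<le> (a * b * c)\<^sup>2"
      using power_mono[OF n_le(2), of 2] b0 by (simp add: power_mult_distrib)
    have "0 < a * c" "0 < b * c" using assms b0 by simp_all
    have ac_bc: "a * c \<le> b * c" using assms b0 by (intro mult_right_mono) auto
    have s2: "s\<^sup>2 \<le> 2 * (a * c)" using s(1) n_le \<open>0 < a * c\<close> by linarith
    have t2: "t\<^sup>2 \<le> 2 * (b * c)" using t(1) n_le ac_bc \<open>0 < b * c\<close> by linarith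
    have aabb: "a * a \<le> b * b" using assms b0 by (intro mult_mono) auto
    have "j = 0 \<or> j = 1 \<or> j = 2" using that by linarith
    then show ?thesis
    proof (elim disjE)
      assume j: "j = 0"
      have "\<bar>p j - \<rho> * sqrt (u j)\<bar> = (a * b) * \<bar>z - sqrt (c * d)\<bar>"
        unfolding j \<rho>u using rr by (simp add: p_def abs_mult right_diff_distrib[symmetric])
      also have "\<dots> \<le> (a * b) * (\<bar>n\<bar> / sqrt (c * d))"
        using ab1 close[OF z] b0 by (intro mult_left_mono) auto
      also have "\<dots> \<le> \<epsilon>"
      proof -
        have "(a * b * \<bar>n\<bar>)\<^sup>2 = (\<bar>n\<bar> * b)\<^sup>2 * (a * a)" by (simp add: power2_eq_square mult_ac)
        also have "\<dots> \<le> (a * b * c)\<^sup>2 * (a * b * c * c)"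
        proof (rule mult_mono)
          show "(\<bar>n\<bar> * b)\<^sup>2 \<le> (a * b * c)\<^sup>2" using sqn zero_le_power2[of "\<bar>n\<bar> * b"] by linarith
          have "a * (a * 1) \<le> a * (b * (c * c))"
            using assms b0 by (intro mult_left_mono mult_mono) (auto intro: mult_mono[of 1 c 1 c, simplified])
          then show "a * a \<le> a * b * c * c" by (simp add: mult_ac)
        qed auto
        finally show ?thesis using main[of "a * b" c] ab1 b0 by (simp add: power2_eq_square power3_eq_cube mult_ac)
      qed
      finally show ?thesis .
    next
      assume j: "j = 1"
      have "\<bar>p j - \<rho> * sqrt (u j)\<bar> = (b * s) * \<bar>x - sqrt (a * d)\<bar>"
        unfolding j \<rho>u using rr s by (simp add: p_def abs_mult right_diff_distrib[symmetric])
      also have "\<dots> \<le> (b * s) * (\<bar>n\<bar> / sqrt (a * d))"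
        using close[OF x] b0 s by (intro mult_left_mono) auto
      also have "\<dots> \<le> \<epsilon>"
      proof -
        have "(b * s * \<bar>n\<bar>)\<^sup>2 = (\<bar>n\<bar> * b)\<^sup>2 * s\<^sup>2" by (simp add: power2_eq_square mult_ac)
        also have "\<dots> \<le> (\<bar>n\<bar> * b)\<^sup>2 * (2 * (a * c))" using s2 by (intro mult_left_mono) auto
        also have "\<dots> \<le> (\<bar>n\<bar> * b)\<^sup>2 * (4 * (a * c))"
          using \<open>0 < a * c\<close> by (intro mult_left_mono) auto
        also have "\<dots> = (\<bar>n\<bar> * b)\<^sup>2 * 4 * (a * c)" by (simp only: mult.assoc)
        also have "\<dots> \<le> (a * b * c)\<^sup>2 * (a * b * c * a)"
        proof (rule mult_mono[OF sqn])
          have "(a * c) * 1 \<le> (a * c) * (a * b)" using ab1 \<open>0 < a * c\<close> by (intro mult_left_mono) auto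
          then show "a * c \<le> a * b * c * a" by (simp add: mult_ac)
        qed (use \<open>0 < a * c\<close> in auto)
        finally show ?thesis using main[of "b * s" a] s b0 by (simp add: power2_eq_square power3_eq_cube mult_ac)
      qed
      finally show ?thesis .
    next
      assume j: "j = 2"
      have "\<bar>p j - \<rho> * sqrt (u j)\<bar> = (a * t) * \<bar>y - sqrt (b * d)\<bar>"
        unfolding j \<rho>u using rr t by (simp add: p_def abs_mult right_diff_distrib[symmetric])
      also have "\<dots> \<le> (a * t) * (\<bar>n\<bar> / sqrt (b * d))"
        using close[OF y] b0 t by (intro mult_left_mono) auto
      also have "\<dots> \<le> \<epsilon>"
      proof -
        have "(a * t * \<bar>n\<bar>)\<^sup>2 = (\<bar>n\<bar>\<^sup>2 * (a * a)) * t\<^sup>2" by (simp add: power2_eq_square mult_ac)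
        also have "\<dots> \<le> (\<bar>n\<bar>\<^sup>2 * (b * b)) * (2 * (b * c))"
          by (rule mult_mono[OF mult_left_mono[OF aabb zero_le_power2] t2]) (use aabb in simp_all)
        also have "\<bar>n\<bar>\<^sup>2 * (b * b) = (\<bar>n\<bar> * b)\<^sup>2" by (simp add: power2_eq_square mult_ac)
        also have "(\<bar>n\<bar> * b)\<^sup>2 * (2 * (b * c)) \<le> (\<bar>n\<bar> * b)\<^sup>2 * (4 * (b * c))"
          using \<open>0 < b * c\<close> by (intro mult_left_mono) auto
        also have "\<dots> = (\<bar>n\<bar> * b)\<^sup>2 * 4 * (b * c)" by (simp only: mult.assoc)
        also have "\<dots> \<le> (a * b * c)\<^sup>2 * (a * b * c * b)"
        proof (rule mult_mono[OF sqn])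
          have "(b * c) * 1 \<le> (b * c) * (a * b)" using ab1 \<open>0 < b * c\<close> by (intro mult_left_mono) auto
          then show "b * c \<le> a * b * c * b" by (simp add: mult_ac)
        qed (use \<open>0 < b * c\<close> in auto)
        finally show ?thesis using main[of "a * t" b] t b0 by (simp add: power2_eq_square power3_eq_cube mult_ac)
      qed
      finally show ?thesis .
    qed
  qed
  have \<rho>d: "sqrt d \<le> \<rho>"
  proof -
    have "1 * real_of_int d \<le> real_of_int a * b * d"
      using rr mult_mono[of 1 "real_of_int a" 1 b] by (intro mult_right_mono) auto
    then show ?thesis by (simp add: \<rho>_def)
  qed
  have \<rho>0: "0 < \<rho>" using \<rho>d rr by (meson less_le_trans real_sqrt_gt_zero)
  have \<rho>_le: "\<rho> \<le> sqrt d * sqrt N"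
  proof -
    have "a * b * d \<le> (a * b * c) * d" using b0 ab1 assms(6) by (intro mult_right_mono) auto
    then have "sqrt (real_of_int (a * b * d)) \<le> sqrt (real_of_int ((a * b * c) * d))"
      by (simp only: real_sqrt_le_iff of_int_le_iff)
    then show ?thesis by (simp add: \<rho>_def N_def real_sqrt_mult mult_ac)
  qed
  show False
  proof (rule no_simultaneous_approximation[OF assms(8) _ _ dist \<rho>0 eps, where L = "N / 2" and U = "2 * N"])
    fix j :: nat assume "j < 3"
    from u_range[OF this] have "real_of_int (a * b * c) \<le> 2 * u j" "u j \<le> 2 * real_of_int (a * b * c)" "1 \<le> u j"
      using abc1 by linarith+
    then show "1 \<le> u j \<and> N / 2 \<le> u j \<and> u j \<le> 2 * N" by (simp add: N_def)
  next
    show "0 < N / 2" using N1 by simp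
  next
    have "3 * (16 * (2 * N)) ^ k * \<epsilon> = 3 * 32 ^ k * N ^ k * (N * sqrt N) / sqrt d"
    proof -
      have "16 * (2 * N) = 32 * N" by simp
      then show ?thesis by (simp only: \<epsilon>_def power_mult_distrib times_divide_eq_right mult.assoc)
    qed
    also have "\<dots> < sqrt d * ((1/16) ^ k * sqrt N / (2 * N) ^ (2 * k))"
    proof -
      have "3 * 32 ^ k * N ^ k * (N * sqrt N) * (16 ^ k * (2 * N) ^ (2 * k))
          = (3 * 2048 ^ k * N ^ (3 * k + 1)) * sqrt N"
      proof -
        \<comment> \<open>The factors come from the coefficient bound (32), the lower bound for the
          form (16) and the power \<open>(2 * N) ^ (2 * k)\<close> (4).\<close>
        have "(2048 :: real) ^ k = (32 * 16 * 2 ^ 2) ^ k" by simp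
        also have "\<dots> = 32 ^ k * 16 ^ k * 2 ^ (2 * k)" by (simp only: power_mult_distrib power_mult)
        finally have e: "(2048 :: real) ^ k = 32 ^ k * 16 ^ k * 2 ^ (2 * k)" .
        have e2: "N ^ (3 * k + 1) = N ^ k * N ^ (2 * k) * N" by (simp add: power_add[symmetric])
        show ?thesis unfolding e e2 power_mult_distrib by simp
      qed
      also have "\<dots> < d * sqrt N" using low N1 by (intro mult_strict_right_mono) auto
      also have "\<dots> = sqrt d * sqrt d * sqrt N" using rr by simp
      finally show ?thesis using N1 rr by (simp add: divide_simps power_one_over)
    qed
    also have "\<dots> \<le> \<rho> * ((1/16) ^ k * sqrt (2 * N) / (2 * N) ^ (2 * k))"
      using \<rho>d \<rho>0 N1 by (intro mult_mono divide_right_mono mult_left_mono) auto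
    finally show "3 * (16 * (2 * N)) ^ k * \<epsilon> < \<rho> * ((1/16) ^ k * sqrt (2 * N) / (2 * N) ^ (2 * k))" .
  next
    define E where "E = real_of_int ((\<bar>n\<bar> * b) ^ 3)"
    have DE: "real_of_int \<bar>(u 0 - u 1) * (u 0 - u 2) * (u 1 - u 2)\<bar> \<le> E"
      unfolding E_def using D by (simp only: of_int_le_iff)
    have E9: "E ^ 3 = (real_of_int (\<bar>n\<bar> * b)) ^ 9" by (simp add: E_def power_mult[symmetric])
    \<comment> \<open>Of the factor \<open>16 ^ k\<close> one half clears binomial denominators, the
      other comes from \<open>(N / 2) ^ (2 * k)\<close>. Three node differences to the power
      \<open>3 * k\<close> produce the exponent 9.\<close>
    have "2 * \<rho> * (sqrt (N / 2) / (N / 2) ^ (2 * k)) * (4 ^ k * real_of_int \<bar>(u 0 - u 1) * (u 0 - u 2) * (u 1 - u 2)\<bar> ^ (3 * k))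
      \<le> 2 * (sqrt d * sqrt N) * (sqrt N / (N / 2) ^ (2 * k)) * (4 ^ k * E ^ (3 * k))"
      using \<rho>_le \<rho>0 N1 rr DE
      by (intro mult_mono mult_left_mono divide_right_mono power_mono mult_nonneg_nonneg) auto
    also have "\<dots> = (2 * sqrt d * N * (16 * real_of_int (\<bar>n\<bar> * b) ^ 9) ^ k) / N ^ (2 * k)"
    proof -
      have "(N / 2) ^ (2 * k) = N ^ (2 * k) / 4 ^ k" by (simp add: power_divide power_mult)
      moreover have "(16 :: real) ^ k = 4 ^ k * 4 ^ k" by (simp add: power_mult_distrib[symmetric])
      moreover have "sqrt N * sqrt N = N" using N1 by simp
      ultimately show ?thesis
        unfolding E9[symmetric] power_mult_distrib[of 16] power_mult by (simp add: field_simps)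
    qed
    also have "\<dots> \<le> 1" using high N1 by (simp add: divide_le_eq)
    finally show "2 * \<rho> * (sqrt (N / 2) / (N / 2) ^ (2 * k))
      * (4 ^ k * real_of_int \<bar>(u 0 - u 1) * (u 0 - u 2) * (u 1 - u 2)\<bar> ^ (3 * k)) \<le> 1" .
  qed
qed

subsection \<open>The gap principle\<close>

lemma abs_le_square_int:
  fixes n :: int
  assumes "n \<noteq> 0"
  shows "1 \<le> n\<^sup>2" "\<bar>n\<bar> \<le> n\<^sup>2"
proof -
  have "1 \<le> \<bar>n\<bar>" using assms by simp
  moreover from this have "\<bar>n\<bar> * 1 \<le> \<bar>n\<bar> * \<bar>n\<bar>" by (intro mult_left_mono) auto
  ultimately show "1 \<le> n\<^sup>2" "\<bar>n\<bar> \<le> n\<^sup>2" by (simp_all add: power2_eq_square)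
qed

text \<open>The integer \<open>e\<close> extends the triple in the sense that \<open>p * e\<close>,
  \<open>q * e\<close> and \<open>w * e\<close> become squares after adding
  \<open>n\<^sup>2\<close>. The identity \<open>key\<close> expresses \<open>w\<close> through
  \<open>e\<close>: for \<open>e = 0\<close> the triple is the regular one, and for
  \<open>e \<ge> 1\<close> the third element is large.\<close>

lemma gap_triple:
  fixes n p q w r s t :: int
  assumes "n \<noteq> 0" "n\<^sup>2 \<le> p" "p < q" "q < w"
    and r: "p * q + n = r\<^sup>2" "0 \<le> r" and s: "p * w + n = s\<^sup>2" "0 \<le> s" and t: "q * w + n = t\<^sup>2" "0 \<le> t"
  shows "w = p + q + 2 * r \<or> 2 * p * q \<le> n\<^sup>2 * w \<and> 4 * q \<le> w"
proof -
  define e where "e = n * (p + q + w) + 2 * p * q * w - 2 * r * s * t"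
  define x where "x = r * s - p * t"
  define y where "y = r * t - q * s"
  define z where "z = s * t - w * r"
  have sq: "r * r = p * q + n" "s * s = p * w + n" "t * t = q * w + n"
    using r s t by (simp_all add: power2_eq_square)
  have x2: "x\<^sup>2 = p * e + n\<^sup>2"
  proof -
    have "x\<^sup>2 = (r * r) * (s * s) + p * p * (t * t) - 2 * p * r * s * t"
      unfolding x_def by (simp add: power2_eq_square algebra_simps)
    then show ?thesis unfolding sq e_def by (simp add: power2_eq_square algebra_simps)
  qed
  have y2: "y\<^sup>2 = q * e + n\<^sup>2"
  proof -
    have "y\<^sup>2 = (r * r) * (t * t) + q * q * (s * s) - 2 * q * r * s * t"
      unfolding y_def by (simp add: power2_eq_square algebra_simps)
    then show ?thesis unfolding sq e_def by (simp add: power2_eq_square algebra_simps)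
  qed
  have z2: "z\<^sup>2 = w * e + n\<^sup>2"
  proof -
    have "z\<^sup>2 = (s * s) * (t * t) + w * w * (r * r) - 2 * w * r * s * t"
      unfolding z_def by (simp add: power2_eq_square algebra_simps)
    then show ?thesis unfolding sq e_def by (simp add: power2_eq_square algebra_simps)
  qed
  have key: "n\<^sup>2 * w = n\<^sup>2 * (p + q) + n * e + 2 * p * q * e + 2 * (r * (x * y))"
  proof -
    have "r * (x * y) = (r * r) * (r * s * t) - q * (r * r) * (s * s) - p * (r * r) * (t * t) + p * q * (r * s * t)"
      unfolding x_def y_def by (simp add: algebra_simps)
    then show ?thesis unfolding sq e_def by (simp add: power2_eq_square algebra_simps)
  qed
  note n2 = abs_le_square_int[OF assms(1)]
  have p1: "1 \<le> p" using n2 assms(2) by linarith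
  \<comment> \<open>A negative \<open>e\<close> would make \<open>w * e + n\<^sup>2\<close>
    negative, as \<open>w > n\<^sup>2\<close>, although it is a square.\<close>
  have e0: "0 \<le> e"
  proof (rule ccontr)
    assume "\<not> 0 \<le> e"
    then have "w * e \<le> w * (- 1)" using assms p1 by (intro mult_left_mono) auto
    then have "z\<^sup>2 < 0" using z2 assms(2-4) by linarith
    then show False using zero_le_power2[of z] by linarith
  qed
  have rs: "(r * s)\<^sup>2 - (p * t)\<^sup>2 = n * (p * (q - p) + s\<^sup>2)"
    unfolding power_mult_distrib r(1)[symmetric] s(1)[symmetric] t(1)[symmetric]
    by (simp add: power2_eq_square algebra_simps)
  have rt: "(r * t)\<^sup>2 - (q * s)\<^sup>2 = n * (q * (w - q) + r\<^sup>2)"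
    unfolding power_mult_distrib r(1)[symmetric] s(1)[symmetric] t(1)[symmetric]
    by (simp add: power2_eq_square algebra_simps)
  have pos: "0 < p * (q - p) + s\<^sup>2" "0 < q * (w - q) + r\<^sup>2"
    using assms p1 by (auto intro!: add_pos_nonneg)
  \<comment> \<open>Both \<open>x\<close> and \<open>y\<close> have the sign of \<open>n\<close>,
    since \<open>rs\<close> and \<open>rt\<close> are \<open>n\<close> times positive
    numbers.\<close>
  have xy: "0 \<le> x * y"
  proof (cases "n > 0")
    case True
    then have "(p * t)\<^sup>2 \<le> (r * s)\<^sup>2" "(q * s)\<^sup>2 \<le> (r * t)\<^sup>2"
      using rs rt pos mult_pos_pos[of n] by (smt (verit))+
    then have "p * t \<le> r * s" "q * s \<le> r * t"
      using r s t by (auto intro: power2_le_imp_le)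
    then show ?thesis by (simp add: x_def y_def)
  next
    case False
    then have "n < 0" using assms(1) by simp
    then have "(r * s)\<^sup>2 \<le> (p * t)\<^sup>2" "(r * t)\<^sup>2 \<le> (q * s)\<^sup>2"
      using rs rt pos mult_neg_pos[of n] by (smt (verit))+
    then have "r * s \<le> p * t" "r * t \<le> q * s"
      using t s p1 assms by (auto intro: power2_le_imp_le)
    then show ?thesis unfolding x_def y_def by (intro mult_nonpos_nonpos) auto
  qed
  show ?thesis
  proof (cases "e = 0")
    case True
    have "(x * y)\<^sup>2 = (n\<^sup>2)\<^sup>2"
      unfolding power_mult_distrib x2 y2 True by (simp add: power2_eq_square)
    then have "x * y = n\<^sup>2" using xy by (metis power2_eq_iff_nonneg zero_le_power2)
    then have "n\<^sup>2 * w = n\<^sup>2 * (p + q + 2 * r)" using key True by (simp add: algebra_simps)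
    then show ?thesis using assms(1) by simp
  next
    case False
    then have e1: "1 \<le> e" using e0 by simp
    have pq: "n\<^sup>2 * q \<le> p * q" using assms p1 by (intro mult_right_mono) auto
    have q2: "2 \<le> q" using p1 assms by simp
    have n2q: "n\<^sup>2 * 2 \<le> n\<^sup>2 * q" using q2 by (intro mult_left_mono) auto
    have npq: "0 \<le> p * q + n" using r by simp
    have "(p * q + (p * q + n)) * 1 \<le> (p * q + (p * q + n)) * e"
      using e1 npq p1 assms by (intro mult_left_mono) auto
    then have A: "2 * p * q + n \<le> n * e + 2 * p * q * e" by (simp add: algebra_simps)
    \<comment> \<open>Multiply \<open>r\<^sup>2 \<ge> n\<^sup>2 * (q - 1)\<close>,
      \<open>x\<^sup>2 \<ge> 2 * n\<^sup>2\<close> and \<open>y\<^sup>2 \<ge> q + 1\<close>; the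
      loss in \<open>q\<^sup>2 - 1\<close> is absorbed by the factor 2.\<close>
    have rxy: "n\<^sup>2 * q \<le> r * (x * y)"
    proof (rule power2_le_imp_le)
      have "(n\<^sup>2 * (q - 1)) * (2 * n\<^sup>2 * (q + 1)) \<le> r\<^sup>2 * (x\<^sup>2 * y\<^sup>2)"
      proof (intro mult_mono)
        show "n\<^sup>2 * (q - 1) \<le> r\<^sup>2" using pq n2 r(1) by (simp add: algebra_simps)
        have "n\<^sup>2 \<le> p * e" using assms(2) e1 p1 mult_left_mono[of 1 e p] by linarith
        then show "2 * n\<^sup>2 \<le> x\<^sup>2" using x2 by linarith
        have "q \<le> q * e" using e1 q2 mult_left_mono[of 1 e q] by linarith
        then show "q + 1 \<le> y\<^sup>2" using y2 n2 by linarith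
      qed (use q2 in auto)
      moreover have "(n\<^sup>2 * q)\<^sup>2 \<le> (n\<^sup>2 * (q - 1)) * (2 * n\<^sup>2 * (q + 1))"
      proof -
        have "q * q \<ge> 2 * 2" using q2 by (intro mult_mono) auto
        then have "(n\<^sup>2 * n\<^sup>2) * (q * q) \<le> (n\<^sup>2 * n\<^sup>2) * (2 * (q * q) - 2)"
          by (intro mult_left_mono) auto
        then show ?thesis by (simp add: power2_eq_square algebra_simps)
      qed
      ultimately show "(n\<^sup>2 * q)\<^sup>2 \<le> (r * (x * y))\<^sup>2" by (simp add: power_mult_distrib)
      show "0 \<le> r * (x * y)" using r xy by simp
    qed
    have np: "n\<^sup>2 \<le> n\<^sup>2 * p" using p1 mult_left_mono[of 1 p "n\<^sup>2"] by simp
    have "2 * p * q \<le> n\<^sup>2 * w"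
      using key A rxy n2q np n2 by (simp add: distrib_left)
    moreover have "4 * (n\<^sup>2 * q) \<le> n\<^sup>2 * w"
      using key A rxy n2q np n2 pq unfolding distrib_left by linarith
    then have "n\<^sup>2 * (4 * q) \<le> n\<^sup>2 * w" by (simp only: mult.left_commute)
    then have "4 * q \<le> w" using n2 assms(1) by (simp add: mult_le_cancel_left)
    ultimately show ?thesis by simp
  qed
qed

text \<open>If the bound fails, \<open>b, c, d\<close> is regular, so
  \<open>d = b + c + 2 * t < 4 * c\<close>. The triple \<open>a, c, d\<close> must then be regular
  too, giving \<open>d = a + c + 2 * s\<close>, which is smaller. The fourth element
  \<open>a\<close> thus excludes the regular case.\<close>

lemma gap_principle:
  fixes n a b c d :: int
  assumes "n \<noteq> 0" "n\<^sup>2 \<le> a" "a < b" "b < c" "c < d"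
    and "\<exists>m. a * c + n = m\<^sup>2" "\<exists>m. a * d + n = m\<^sup>2" "\<exists>m. b * c + n = m\<^sup>2" "\<exists>m. b * d + n = m\<^sup>2"
      "\<exists>m. c * d + n = m\<^sup>2"
  shows "2 * b * c \<le> n\<^sup>2 * d"
proof (rule ccontr)
  assume no: "\<not> ?thesis"
  have nonneg: "\<exists>m\<ge>0. i = m\<^sup>2" if "\<exists>m. i = m\<^sup>2" for i :: int
    using that by (metis abs_ge_zero power2_abs)
  obtain s where s: "a * c + n = s\<^sup>2" "0 \<le> s" using nonneg assms(6) by blast
  obtain t where t: "b * c + n = t\<^sup>2" "0 \<le> t" using nonneg assms(8) by blast
  obtain x where x: "a * d + n = x\<^sup>2" "0 \<le> x" using nonneg assms(7) by blast
  obtain y where y: "b * d + n = y\<^sup>2" "0 \<le> y" using nonneg assms(9) by blast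
  obtain z where z: "c * d + n = z\<^sup>2" "0 \<le> z" using nonneg assms(10) by blast
  note n2 = abs_le_square_int[OF assms(1)]
  have d: "d = b + c + 2 * t"
    using gap_triple[OF assms(1) _ assms(4,5) t y z] assms(2,3) no by linarith
  have "t\<^sup>2 \<le> c\<^sup>2"
  proof -
    have "b * c \<le> (c - 1) * c" using assms n2 by (intro mult_right_mono) auto
    then show ?thesis using t(1) n2 assms(2-4) unfolding power2_eq_square[of c] left_diff_distrib by linarith
  qed
  then have "t \<le> c" by (rule power2_le_imp_le) (use n2 assms(2-4) in linarith)
  have "a * c \<le> b * c" by (rule mult_right_mono) (use n2 assms(2-4) in linarith)+
  then have "s\<^sup>2 \<le> t\<^sup>2" using s t by linarith
  then have "s \<le> t" using t(2) by (rule power2_le_imp_le)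
  have "d = a + c + 2 * s \<or> 4 * c \<le> d"
    using gap_triple[OF assms(1,2) _ assms(5) s x z] assms(3,4) by linarith
  then show False using d \<open>s \<le> t\<close> \<open>t \<le> c\<close> assms(3,4) by linarith
qed

subsection \<open>The bound\<close>

text \<open>The half-open intervals between consecutive powers cover everything from the starting
  power on; the least \<open>K\<close> whose power exceeds \<open>d\<close> gives
  \<open>k = K - 1\<close>.\<close>

lemma power_bracket:
  fixes M d :: real
  assumes "2 \<le> M" "M ^ (49 * 15 + 17) \<le> d"
  shows "\<exists>k\<ge>15. M ^ (49 * k + 17) \<le> d \<and> d < M ^ (49 * Suc k + 17)"
proof -
  obtain m where m: "d < 2 ^ m" using real_arch_pow[of 2 d] by auto
  have "(2::real) ^ m \<le> M ^ m" using assms(1) by (intro power_mono) auto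
  also have "\<dots> \<le> M ^ (49 * m + 17)" using assms(1) by (intro power_increasing) auto
  finally have ex: "d < M ^ (49 * m + 17)" using m by linarith
  define K where "K = (LEAST K. d < M ^ (49 * K + 17))"
  have K: "d < M ^ (49 * K + 17)" unfolding K_def by (rule LeastI[of _ m]) (rule ex)
  have min: "M ^ (49 * k + 17) \<le> d" if "k < K" for k
    using not_less_Least[OF that[unfolded K_def]] by simp
  have "15 < K"
  proof (rule ccontr)
    assume "\<not> 15 < K"
    then have "M ^ (49 * K + 17) \<le> M ^ (49 * 15 + 17)" using assms(1) by (intro power_increasing) auto
    then show False using K assms(2) by linarith
  qed
  then have "15 \<le> K - 1" "K - 1 < K" "Suc (K - 1) = K" by simp_all
  then show ?thesis using K min[of "K - 1"] by (metis)
qed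

text \<open>The exponents 144 and 55 are the Fibonacci numbers gained between the 2nd and the 13th and
  between the 13th and the 22nd element. Consecutive intervals for $d$, in terms of
  $M = N^{1/16}$, are $M^{49k+17} \le d \le M^{56k-33}$; they overlap for $k \ge 15$.\<close>

lemma no_large_extension:
  fixes n a b c d :: int
  defines "V \<equiv> 2 * real_of_int b / (real_of_int n)\<^sup>2" and "W \<equiv> 2 * real_of_int c / (real_of_int n)\<^sup>2"
    and "Z \<equiv> 2 * real_of_int d / (real_of_int n)\<^sup>2"
  assumes "n \<noteq> 0" "\<bar>n\<bar> ^ 3 \<le> a" "a < b" "b < c" "c < d"
    and s: "\<exists>m. a * c + n = m\<^sup>2" and t: "\<exists>m. b * c + n = m\<^sup>2" and x: "\<exists>m. a * d + n = m\<^sup>2"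
    and y: "\<exists>m. b * d + n = m\<^sup>2" and z: "\<exists>m. c * d + n = m\<^sup>2"
    and VW: "V ^ 144 \<le> W" and WZ: "W ^ 55 \<le> Z"
  shows False
proof -
  define m where "m = real_of_int \<bar>n\<bar>"
  have m1: "1 \<le> m" using assms(4) by (simp add: m_def)
  have msq: "(real_of_int n)\<^sup>2 = m\<^sup>2" by (simp add: m_def)
  have m2: "1 \<le> m\<^sup>2" using m1 by simp
  have am: "m ^ 3 \<le> a" using assms(5) unfolding m_def by (metis of_int_le_iff of_int_power)
  have m3: "m ^ 3 = m * m\<^sup>2" by (simp add: power3_eq_cube power2_eq_square)
  have m3_1: "1 \<le> m ^ 3" using m1 by simp
  have b: "real_of_int b = V * m\<^sup>2 / 2" and c: "real_of_int c = W * m\<^sup>2 / 2" and d: "real_of_int d = Z * m\<^sup>2 / 2"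
    using m1 by (simp_all add: V_def W_def Z_def msq)
  have ba: "real_of_int a + 1 \<le> b" "real_of_int b + 1 \<le> c" "real_of_int c + 1 \<le> d" using assms(6-8) by linarith+
  \<comment> \<open>The threshold \<open>\<bar>n\<bar> ^ 3\<close> enters here: it lets powers of
    \<open>V\<close> absorb every power of \<open>n\<close>.\<close>
  have mV: "2 * m \<le> V"
  proof -
    have "2 * m * m\<^sup>2 \<le> V * m\<^sup>2" using b am ba m3 by (simp add: algebra_simps)
    then show ?thesis by (rule mult_right_le_imp_le) (use m2 in linarith)
  qed
  have V4: "4 \<le> V"
  proof (cases "m = 1")
    case True
    then show ?thesis using b am ba by simp
  next
    case False
    then have "\<bar>n\<bar> \<noteq> 1" by (auto simp: m_def)
    then have "2 \<le> m" using assms(4) unfolding m_def by linarith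
    then show ?thesis using mV by linarith
  qed
  have V1: "1 \<le> V" "0 \<le> V" using V4 by simp_all
  have W288: "2 ^ 288 \<le> W"
  proof -
    have "(2::real) ^ 288 = 4 ^ 144" by (simp add: power_mult[of 2 2 144, simplified])
    also have "\<dots> \<le> V ^ 144" using V4 by (intro power_mono) auto
    finally show ?thesis using VW by linarith
  qed
  have W2: "2 \<le> W" using W288 by simp
  have msqV: "m\<^sup>2 \<le> V\<^sup>2 / 4"
    using power_mono[OF mV, of 2] m1 by (simp add: power_mult_distrib)
  have bV: "real_of_int b \<le> V ^ 3"
  proof -
    have "real_of_int b \<le> V * (V\<^sup>2 / 4) / 2" unfolding b using msqV V1 by (intro divide_right_mono mult_left_mono) auto
    also have "\<dots> \<le> V ^ 3" using V1 by (simp add: power3_eq_cube power2_eq_square)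
    finally show ?thesis .
  qed
  have cW: "real_of_int c \<le> W * V\<^sup>2"
  proof -
    have "real_of_int c \<le> W * (V\<^sup>2 / 4) / 2" unfolding c using msqV W2 by (intro divide_right_mono mult_left_mono) auto
    also have "\<dots> \<le> W * V\<^sup>2" using W2 by simp
    finally show ?thesis .
  qed
  define N where "N = real_of_int (a * b * c)"
  have a1: "1 \<le> real_of_int a" using am m3_1 by linarith
  have N_ge: "W \<le> N"
  proof -
    have "1 * 2 * real_of_int c \<le> real_of_int a * b * c"
      using a1 ba by (intro mult_mono) auto
    moreover have "W * 1 \<le> W * m\<^sup>2" using m2 W2 by (intro mult_left_mono) auto
    ultimately show ?thesis unfolding N_def of_int_mult using c by linarith
  qed
  have N0: "0 < N" using N_ge W2 by linarith
  have N_le: "N \<le> V ^ 8 * W"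
  proof -
    have "N \<le> V ^ 3 * V ^ 3 * (W * V\<^sup>2)"
      unfolding N_def of_int_mult using bV cW a1 ba V1 W2 by (intro mult_mono) auto
    also have "\<dots> = V ^ 8 * W" by (simp add: power_add[symmetric] algebra_simps)
    finally show ?thesis .
  qed
  \<comment> \<open>From \<open>N \<le> V ^ 8 * W\<close> and \<open>V ^ 144 \<le> W\<close> follows
    \<open>N ^ 18 \<le> W ^ 19\<close>, and \<open>19 * 47 \<le> 54 * 18\<close>.\<close>
  have N_47: "N ^ 47 \<le> W ^ 54"
  proof (rule power_le_imp_le_base)
    have "N ^ 18 \<le> (V ^ 8 * W) ^ 18" using N_le N0 by (intro power_mono) auto
    also have "\<dots> = V ^ 144 * W ^ 18" by (simp add: power_mult_distrib power_mult[symmetric])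
    also have "\<dots> \<le> W * W ^ 18" using VW W2 by (intro mult_right_mono) auto
    also have "\<dots> = W ^ 19" by (simp add: power_Suc[symmetric])
    finally have "(N ^ 18) ^ 47 \<le> (W ^ 19) ^ 47" using N0 by (intro power_mono) auto
    also have "\<dots> \<le> (W ^ 54) ^ 18" unfolding power_mult[symmetric] using W2 by (intro power_increasing) auto
    finally show "(N ^ 47) ^ Suc 17 \<le> (W ^ 54) ^ Suc 17" by (simp add: power_mult[symmetric])
  qed (use W2 in simp)
  \<comment> \<open>One of the 55 powers of \<open>W\<close> pays for the factor 2 in the
    normalisation of \<open>Z\<close>.\<close>
  have d_ge: "W ^ 54 \<le> d"
  proof -
    have "2 * W ^ 54 \<le> W * W ^ 54" using W2 by (intro mult_right_mono) auto
    also have "\<dots> = W ^ 55" by (simp add: power_Suc[symmetric])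
    finally have WZ2: "2 * W ^ 54 \<le> Z" using WZ by linarith
    then have "0 \<le> Z" using W2 zero_le_power[of W 54] by linarith
    then have "Z * 1 \<le> Z * m\<^sup>2" using m2 by (intro mult_left_mono) auto
    then show ?thesis using d WZ2 by linarith
  qed
  \<comment> \<open>With this unit \<open>2048 \<le> M\<close> and
    \<open>16 * (m * b) ^ 9 \<le> V ^ 36 \<le> M ^ 4\<close>, so both range conditions become
    comparisons of exponents of \<open>M\<close>.\<close>
  define M where "M = root 16 N"
  have M16: "M ^ 16 = N" using N0 by (simp add: M_def)
  have M0: "0 \<le> M" using N0 by (simp add: M_def)
  have M2048: "2048 \<le> M"
  proof (rule power_le_imp_le_base[of _ 15])
    have "(2048::real) ^ Suc 15 \<le> 2 ^ 288" by simp
    then show "2048 ^ Suc 15 \<le> M ^ Suc 15" using W288 N_ge M16 by simp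
  qed (rule M0)
  have E: "16 * (m * b) ^ 9 \<le> M ^ 4"
  proof -
    have "m * b \<le> V ^ 4 / 16"
    proof -
      have "m * b \<le> (V / 2) * (V * (V\<^sup>2 / 4) / 2)"
        unfolding b using msqV V1 mV m1 by (intro mult_mono divide_right_mono mult_left_mono) auto
      also have "\<dots> = V ^ 4 / 16" by (simp add: power4_eq_xxxx power2_eq_square)
      finally show ?thesis .
    qed
    then have "(m * b) ^ 9 \<le> (V ^ 4 / 16) ^ 9" using m1 a1 ba by (intro power_mono) auto
    also have "\<dots> = V ^ 36 / 16 ^ 9" by (simp add: power_divide power_mult[symmetric])
    finally have "16 * (m * b) ^ 9 \<le> 16 * (V ^ 36 / 16 ^ 9)" by simp
    also have "\<dots> \<le> V ^ 36" using V1 zero_le_power[of V 36] by simp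
    also have "\<dots> \<le> M ^ 4"
    proof (rule power_le_imp_le_base[of _ 3])
      have "V ^ 144 \<le> M ^ 16" using VW N_ge M16 by linarith
      then show "(V ^ 36) ^ Suc 3 \<le> (M ^ 4) ^ Suc 3" by (simp add: power_mult[symmetric])
    qed (use M0 in simp)
    finally show ?thesis .
  qed
  \<comment> \<open>\<open>49 * 15 + 17 = 752 = 16 * 47\<close>, so the covered range starts where
    \<open>N_47\<close> and \<open>d_ge\<close> place \<open>d\<close>.\<close>
  have "M ^ (49 * 15 + 17) = N ^ 47" unfolding M16[symmetric] by (simp add: power_mult[symmetric])
  then have "M ^ (49 * 15 + 17) \<le> d" using N_47 d_ge by linarith
  then obtain k where k: "15 \<le> k" "M ^ (49 * k + 17) \<le> d" "d < M ^ (49 * Suc k + 17)"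
    using power_bracket[of M d] M2048 by auto
  have d0: "0 \<le> real_of_int d" using a1 ba by linarith
  have nonneg: "\<exists>j\<ge>0. i = j\<^sup>2" if "\<exists>j. i = j\<^sup>2" for i :: int
    using that by (metis abs_ge_zero power2_abs)
  obtain s' where s': "a * c + n = s'\<^sup>2" "0 \<le> s'" using nonneg[OF s] by blast
  obtain t' where t': "b * c + n = t'\<^sup>2" "0 \<le> t'" using nonneg[OF t] by blast
  obtain x' where x': "a * d + n = x'\<^sup>2" "0 \<le> x'" using nonneg[OF x] by blast
  obtain y' where y': "b * d + n = y'\<^sup>2" "0 \<le> y'" using nonneg[OF y] by blast
  obtain z' where z': "c * d + n = z'\<^sup>2" "0 \<le> z'" using nonneg[OF z] by blast
  show False
  proof (rule no_square_triple_in_range[OF assms(4) _ assms(6,7) _ _ _ s' t' x' y' z'])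
    show "0 < a" "0 < d" "1 \<le> k" using a1 ba k(1) by linarith+
    have "real_of_int (2 * \<bar>n\<bar>) \<le> real_of_int (a * c)"
    proof -
      have "m * 1 \<le> m * m\<^sup>2" using m1 m2 by (intro mult_left_mono) auto
      then have "m \<le> a" using am m3 by linarith
      then have "m * 2 \<le> real_of_int a * c" using ba a1 m1 by (intro mult_mono) auto
      then show ?thesis by (simp add: m_def)
    qed
    then show "2 * \<bar>n\<bar> \<le> a * c" by (simp only: of_int_le_iff)
  next
    have "3 * 2048 ^ k * N ^ (3 * k + 1) \<le> 3 * M ^ k * N ^ (3 * k + 1)"
      using M2048 N0 by (intro mult_right_mono mult_left_mono power_mono) auto
    also have "\<dots> = 3 * M ^ (49 * k + 16)"
      unfolding M16[symmetric] power_mult[symmetric] mult.assoc power_add[symmetric]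
      by (simp add: algebra_simps)
    also have "\<dots> < M * M ^ (49 * k + 16)" using M2048 by (intro mult_strict_right_mono) auto
    also have "\<dots> \<le> d"
    proof -
      have "49 * k + 17 = Suc (49 * k + 16)" by simp
      then show ?thesis using k(2) by (simp only: power_Suc)
    qed
    finally show "3 * 2048 ^ k * real_of_int (a * b * c) ^ (3 * k + 1) < d" unfolding N_def .
  next
    have "4 * real_of_int d \<le> M * M ^ (49 * Suc k + 17)"
      using k(3) M2048 d0 by (intro mult_mono) auto
    also have "\<dots> = M ^ (49 * k + 67)"
    proof -
      have "Suc (49 * Suc k + 17) = 49 * k + 67" by simp
      then show ?thesis by (simp only: power_Suc[symmetric])
    qed
    \<comment> \<open>The inequality \<open>49 * k + 67 \<le> 56 * k - 32\<close> holds exactly from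
      \<open>k = 15\<close> on.\<close>
    also have "\<dots> \<le> M ^ (2 * (28 * k - 16))" using M2048 k(1) by (intro power_increasing) auto
    also have "\<dots> = (M ^ (28 * k - 16))\<^sup>2" by (simp add: power_mult[symmetric] mult.commute)
    finally have "sqrt (4 * d) \<le> sqrt ((M ^ (28 * k - 16))\<^sup>2)" by (simp only: real_sqrt_le_iff of_int_mult of_int_numeral)
    then have sd: "2 * sqrt d \<le> M ^ (28 * k - 16)" using M0 by (simp add: real_sqrt_mult)
    have "2 * sqrt d * N * (16 * (m * b) ^ 9) ^ k \<le> M ^ (28 * k - 16) * M ^ 16 * (M ^ 4) ^ k"
      using sd E M0 M16 N0 m1 a1 ba d0 by (intro mult_mono power_mono) auto
    also have "\<dots> = M ^ ((28 * k - 16) + 16 + 4 * k)" by (simp only: power_add power_mult)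
    also have "(28 * k - 16) + 16 + 4 * k = 16 * (2 * k)" using k(1) by simp
    also have "M ^ (16 * (2 * k)) = N ^ (2 * k)" by (simp only: power_mult M16)
    finally show "2 * sqrt d * real_of_int (a * b * c) * (16 * real_of_int (\<bar>n\<bar> * b) ^ 9) ^ k
        \<le> real_of_int (a * b * c) ^ (2 * k)"
      by (simp add: N_def m_def)
  qed
qed

section \<open>Fibonacci growth and the count of elements\<close>

text \<open>Multiplying neighbours adds exponents, which is the Fibonacci recursion; both starting
  values have exponent one. The base point \<open>p\<close> is free so that growth can be restarted
  from a later element.\<close>

lemma fibonacci_growth:
  fixes f :: "nat \<Rightarrow> real"
  assumes "1 \<le> X" "X \<le> f p" "X \<le> f (Suc p)"
    and "\<And>i. p \<le> i \<Longrightarrow> Suc (Suc i) \<le> p + m \<Longrightarrow> f i * f (Suc i) \<le> f (Suc (Suc i))"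
    and "j \<le> m"
  shows "X ^ fib (Suc j) \<le> f (p + j)"
  using assms(5)
proof (induction j rule: fib.induct)
  case (3 j)
  have "X ^ fib (Suc (Suc (Suc j))) = X ^ fib (Suc j) * X ^ fib (Suc (Suc j))"
    by (simp add: power_add[symmetric] add.commute)
  also have "\<dots> \<le> f (p + j) * f (p + Suc j)"
  proof (rule mult_mono)
    show "X ^ fib (Suc j) \<le> f (p + j)" "X ^ fib (Suc (Suc j)) \<le> f (p + Suc j)"
      using 3 by simp_all
    then show "0 \<le> f (p + j)" using assms(1) zero_le_power[of X "fib (Suc j)"] by linarith
  qed (use assms(1) in simp)
  also have "\<dots> \<le> f (p + Suc (Suc j))" using assms(4)[of "p + j"] 3(3) by simp
  finally show ?case .
qed (use assms in simp_all)

lemma no_22_elements: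
  fixes n :: int and e :: "nat \<Rightarrow> int"
  assumes "n \<noteq> 0" "\<bar>n\<bar> ^ 3 \<le> e 0"
    and mono: "\<And>i j. i < j \<Longrightarrow> j < 22 \<Longrightarrow> e i < e j"
    and D: "\<And>i j. i < j \<Longrightarrow> j < 22 \<Longrightarrow> \<exists>m. e i * e j + n = m\<^sup>2"
  shows False
proof -
  \<comment> \<open>This scaling turns \<open>2 * b * c \<le> n\<^sup>2 * d\<close> into
    \<open>v i * v (Suc i) \<le> v (Suc (Suc i))\<close>. It holds from \<open>i = 1\<close> on,
    because \<open>e 0\<close> serves as the smaller fourth element.\<close>
  define v where "v i = 2 * real_of_int (e i) / (real_of_int n)\<^sup>2" for i
  have n0: "0 < (real_of_int n)\<^sup>2" using assms(1) by simp
  note n2 = abs_le_square_int[OF assms(1)]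
  have n23: "n\<^sup>2 \<le> \<bar>n\<bar> ^ 3"
  proof -
    have "\<bar>n\<bar> ^ 2 \<le> \<bar>n\<bar> ^ 3" using assms(1) by (intro power_increasing) auto
    then show ?thesis by simp
  qed
  have step: "v i * v (Suc i) \<le> v (Suc (Suc i))" if "1 \<le> i" "Suc (Suc i) \<le> 21" for i
  proof -
    have "2 * e i * e (Suc i) \<le> n\<^sup>2 * e (Suc (Suc i))"
      by (rule gap_principle[of n "e 0"]) (use that assms n23 in \<open>auto intro!: mono D\<close>)
    then have "real_of_int (2 * e i * e (Suc i)) \<le> real_of_int (n\<^sup>2 * e (Suc (Suc i)))"
      by (simp only: of_int_le_iff)
    then have "2 * real_of_int (e i) * e (Suc i) / (real_of_int n)\<^sup>2 \<le> e (Suc (Suc i))"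
      using n0 by (simp add: divide_le_eq mult.commute)
    then have "2 * (2 * real_of_int (e i) * e (Suc i) / (real_of_int n)\<^sup>2) / (real_of_int n)\<^sup>2 \<le> v (Suc (Suc i))"
      using n0 unfolding v_def by (intro divide_right_mono) auto
    then show ?thesis by (simp add: v_def mult.commute mult.left_commute)
  qed
  have v_mono: "v i \<le> v j" if "i < j" "j < 22" for i j
    using mono[OF that] n0 by (simp add: v_def divide_le_cancel)
  have v1: "1 \<le> v 1"
  proof -
    have "n\<^sup>2 \<le> 2 * e 1" using n23 assms(2) mono[of 0 1] n2 by simp
    then have "real_of_int (n\<^sup>2) \<le> real_of_int (2 * e 1)" by (simp only: of_int_le_iff)
    then show ?thesis using n0 by (simp add: v_def)
  qed
  \<comment> \<open>Eleven steps from index 1 to 12 and nine from 12 to 21 supply the exponents 144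
    and 55.\<close>
  have fib: "fib (Suc 11) = 144" "fib (Suc 9) = 55" by (simp_all add: eval_nat_numeral)
  have "v 1 ^ fib (Suc 11) \<le> v (1 + 11)"
  proof (rule fibonacci_growth)
    show "\<And>i. 1 \<le> i \<Longrightarrow> Suc (Suc i) \<le> 1 + 20 \<Longrightarrow> v i * v (Suc i) \<le> v (Suc (Suc i))"
      by (rule step) simp_all
  qed (use v1 v_mono[of 1 "Suc 1"] in simp_all)
  then have VW: "v 1 ^ 144 \<le> v 12" unfolding fib by simp
  have v12: "1 \<le> v 12" using v1 v_mono[of 1 12] by simp
  have "v 12 ^ fib (Suc 9) \<le> v (12 + 9)"
  proof (rule fibonacci_growth)
    show "\<And>i. 12 \<le> i \<Longrightarrow> Suc (Suc i) \<le> 12 + 9 \<Longrightarrow> v i * v (Suc i) \<le> v (Suc (Suc i))"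
      by (rule step) simp_all
  qed (use v12 v_mono[of 12 "Suc 12"] in simp_all)
  then have WZ: "v 12 ^ 55 \<le> v 21" unfolding fib by simp
  show False
  proof (rule no_large_extension[of n "e 0" "e 1" "e 12" "e 21"])
    show "(2 * real_of_int (e 1) / (real_of_int n)\<^sup>2) ^ 144 \<le> 2 * real_of_int (e 12) / (real_of_int n)\<^sup>2"
      "(2 * real_of_int (e 12) / (real_of_int n)\<^sup>2) ^ 55 \<le> 2 * real_of_int (e 21) / (real_of_int n)\<^sup>2"
      using VW WZ unfolding v_def .
  qed (rule assms(1,2) mono D; simp)+
qed

theorem theorem1:
  fixes n :: int and S :: "int set"
  assumes "n \<noteq> 0"
    and "\<forall>x\<in>S. x > 0"
    and "has_property_D n S"
  shows "finite {x\<in>S. x \<ge> \<bar>n\<bar> ^ 3} \<and> card {x\<in>S. x \<ge> \<bar>n\<bar> ^ 3} \<le> 21"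
proof (rule ccontr)
  let ?A = "{x\<in>S. x \<ge> \<bar>n\<bar> ^ 3}"
  assume "\<not> ?thesis"
  then have "infinite ?A \<or> 22 \<le> card ?A" by auto
  \<comment> \<open>Passing to exactly 22 elements treats the infinite and the finite case together
    and permits a sorted enumeration.\<close>
  then obtain B where B: "B \<subseteq> ?A" "finite B" "card B = 22"
    by (meson infinite_arbitrarily_large obtain_subset_with_card_n)
  define e where "e i = sorted_list_of_set B ! i" for i
  have len: "length (sorted_list_of_set B) = 22" using B by simp
  have mono: "e i < e j" if "i < j" "j < 22" for i j
    unfolding e_def using that len strict_sorted_list_of_set[of B]
    by (simp add: sorted_wrt_nth_less)
  have e: "e i \<in> ?A" if "i < 22" for i
    using that len B nth_mem[of i "sorted_list_of_set B"] by (auto simp: e_def)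
  show False
  proof (rule no_22_elements[OF assms(1) _ mono])
    show "\<bar>n\<bar> ^ 3 \<le> e 0" using e[of 0] by simp
    show "\<exists>m. e i * e j + n = m\<^sup>2" if "i < j" "j < 22" for i j
    proof -
      have "e i \<in> S" "e j \<in> S" "e i \<noteq> e j" using e[of i] e[of j] mono[OF that] that by simp_all
      then show ?thesis using assms(3) by (simp add: has_property_D_def)
    qed
  qed
qed

end
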